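(* A displacement field $\mathbf{u}:\Omega\to\mathbb{R}^3$ is universal for the trigonal class $\mathbb{D}_3\oplus\mathbb{Z}_2^c$ of linear strain-gradient elastic solids if and only if it is the superposition (sum) of a homogeneous displacement field and a field $\mathbf{u}^{\mathrm{inh}}$ of the form $$u_1^{\mathrm{inh}}=a_{123}x_1x_2x_3+a_{12}x_1x_2+a_{13}x_1x_3+a_{23}x_2x_3,$$ $$u_2^{\mathrm{inh}}=\tfrac12(a_{12}+a_{123}x_3)(x_1^2-x_2^2)+b_{13}x_1x_3-a_{13}x_2x_3,$$ $$u_3^{\mathrm{inh}}=-a_{123}x_1^2x_2-(a_{23}+b_{13})x_1x_2+\tfrac13a_{123}x_2^3-a_{13}(x_1^2-x_2^2),$$ for some constants $a_{123},a_{12},a_{13},a_{23},b_{13}\in\mathbb{R}$.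
   Context: $\Omega\subset\mathbb{R}^3$ is a nonempty convex open set with Cartesian coordinates $(x_1,x_2,x_3)$ and orthonormal basis $e_1,e_2,e_3$. Repeated indices are summed over $1,2,3$ and a comma denotes partial differentiation. A displacement field is a smooth map $\mathbf{u}:\Omega\to\mathbb{R}^3$, with strain $e_{lm}=\tfrac12(u_{l,m}+u_{m,l})$. It is homogeneous if $\mathbf{u}(\mathbf{x})=\mathbf{H}\mathbf{x}+\mathbf{b}$ for a constant matrix $\mathbf{H}$ and constant vector $\mathbf{b}$. A strain-gradient material is a triple $(\mathsf{C},\mathsf{M},\mathsf{A})$ of constant real tensors of orders $4,5,6$ with index symmetries $\mathsf{C}_{ijlm}=\mathsf{C}_{jilm}=\mathsf{C}_{lmij}$, $\mathsf{M}_{ijklm}=\mathsf{M}_{jiklm}=\mathsf{M}_{ijlkm}$, $\mathsf{A}_{ijklmn}=\mathsf{A}_{jiklmn}=\mathsf{A}_{lmnijk}$. Its stress and hyper-stress are $\sigma_{ij}=\mathsf{C}_{ijlm}e_{lm}+\mathsf{M}_{ijlmn}e_{lm,n}$ and $\tau_{ijk}=\mathsf{M}_{lmijk}e_{lm}+\mathsf{A}_{ijklmn}e_{lm,n}$, and the equilibrium equations without body forces are $\sigma_{ij,j}-\tau_{ijk,jk}=0$ in $\Omega$ for $i=1,2,3$. For a subgroup $G\subset \mathrm{O}(3)$, a tensor $T$ of order $p$ is $G$-invariant if $Q_{i_1j_1}\cdots Q_{i_pj_p}T_{j_1\dots j_p}=T_{i_1\dots i_p}$ for all $Q\in G$. $\mathbb{D}_3$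 is generated by the rotation by $2\pi/3$ about $e_3$ and the rotation by $\pi$ about $e_2$; $\mathbb{Z}_2^c=\{I,-I\}$, and $\mathbb{D}_3\oplus\mathbb{Z}_2^c$ is the group generated by $\mathbb{D}_3$ and $-I$. The trigonal class $\mathbb{D}_3\oplus\mathbb{Z}_2^c$ is the set of all materials with $\mathsf{C}$ and $\mathsf{A}$ $\mathbb{D}_3\oplus\mathbb{Z}_2^c$-invariant (6 and 34 independent constants) and $\mathsf{M}=0$. A displacement field is universal for the class if it satisfies the equilibrium equations for every material in the class. *)

theory Defs
  imports "HOL-Analysis.Analysis" "HOL-Algebra.Generated_Groups"
begin

section \<open>Smooth fields and partial derivatives\<close>

text \<open>On an open set \<open>S\<close>, \<open>Ck_on k S f\<close> says that \<open>f\<close> is \<open>k\<close> times continuously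
  differentiable.\<close>

primrec Ck_on :: "nat \<Rightarrow> 'a::real_normed_vector set \<Rightarrow> ('a \<Rightarrow> 'b::real_normed_vector) \<Rightarrow> bool" where
  "Ck_on 0 S f \<longleftrightarrow> continuous_on S f"
| "Ck_on (Suc k) S f \<longleftrightarrow> (\<forall>x\<in>S. f differentiable (at x)) \<and>
     (\<forall>v. Ck_on k S (\<lambda>x. frechet_derivative f (at x) v))"

definition smooth_on :: "'a::real_normed_vector set \<Rightarrow> ('a \<Rightarrow> 'b::real_normed_vector) \<Rightarrow> bool" where
  "smooth_on S f \<longleftrightarrow> (\<forall>k. Ck_on k S f)"

text \<open>Indices have type \<open>3\<close>, in which the numeral \<open>3\<close> equals \<open>0\<close>; its elements are
  \<open>1\<close>, \<open>2\<close>, \<open>3\<close>, and \<open>axis k 1\<close> is the basis vector with number \<open>k\<close>.\<close>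

definition partial_deriv :: "3 \<Rightarrow> (real^3 \<Rightarrow> real) \<Rightarrow> real^3 \<Rightarrow> real" where
  "partial_deriv k f x = deriv (\<lambda>t. f (x + t *\<^sub>R axis k 1)) 0"

definition displacement_field :: "(real^3) set \<Rightarrow> (real^3 \<Rightarrow> real^3) \<Rightarrow> bool" where
  "displacement_field \<Omega> u \<longleftrightarrow> smooth_on \<Omega> u"

definition homogeneous_field :: "(real^3) set \<Rightarrow> (real^3 \<Rightarrow> real^3) \<Rightarrow> bool" where
  "homogeneous_field \<Omega> u \<longleftrightarrow>
     (\<exists>(H :: real^3^3) (b :: real^3). \<forall>x\<in>\<Omega>. u x = H *v x + b)"

definition strain :: "(real^3 \<Rightarrow> real^3) \<Rightarrow> 3 \<Rightarrow> 3 \<Rightarrow> real^3 \<Rightarrow> real" where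
  "strain u l m x =
     (partial_deriv m (\<lambda>y. u y $ l) x + partial_deriv l (\<lambda>y. u y $ m) x) / 2"


section \<open>Strain-gradient materials and equilibrium\<close>

type_synonym tensor4 = "3 \<Rightarrow> 3 \<Rightarrow> 3 \<Rightarrow> 3 \<Rightarrow> real"
type_synonym tensor5 = "3 \<Rightarrow> 3 \<Rightarrow> 3 \<Rightarrow> 3 \<Rightarrow> 3 \<Rightarrow> real"
type_synonym tensor6 = "3 \<Rightarrow> 3 \<Rightarrow> 3 \<Rightarrow> 3 \<Rightarrow> 3 \<Rightarrow> 3 \<Rightarrow> real"
type_synonym material = "tensor4 \<times> tensor5 \<times> tensor6"

definition strain_gradient_materials :: "material set" where
  "strain_gradient_materials = {(C, M, A).
     (\<forall>i j l m. C i j l m = C j i l m \<and> C i j l m = C l m i j) \<and>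
     (\<forall>i j k l m. M i j k l m = M j i k l m \<and> M i j k l m = M i j l k m) \<and>
     (\<forall>i j k l m n. A i j k l m n = A j i k l m n \<and> A i j k l m n = A l m n i j k)}"

fun stress :: "material \<Rightarrow> (real^3 \<Rightarrow> real^3) \<Rightarrow> 3 \<Rightarrow> 3 \<Rightarrow> real^3 \<Rightarrow> real" where
  "stress (C, M, A) u i j x =
     (\<Sum>l\<in>UNIV. \<Sum>m\<in>UNIV. C i j l m * strain u l m x) +
     (\<Sum>l\<in>UNIV. \<Sum>m\<in>UNIV. \<Sum>n\<in>UNIV. M i j l m n * partial_deriv n (strain u l m) x)"

fun hyper_stress :: "material \<Rightarrow> (real^3 \<Rightarrow> real^3) \<Rightarrow> 3 \<Rightarrow> 3 \<Rightarrow> 3 \<Rightarrow> real^3 \<Rightarrow> real" where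
  "hyper_stress (C, M, A) u i j k x =
     (\<Sum>l\<in>UNIV. \<Sum>m\<in>UNIV. M l m i j k * strain u l m x) +
     (\<Sum>l\<in>UNIV. \<Sum>m\<in>UNIV. \<Sum>n\<in>UNIV. A i j k l m n * partial_deriv n (strain u l m) x)"

definition in_equilibrium :: "(real^3) set \<Rightarrow> material \<Rightarrow> (real^3 \<Rightarrow> real^3) \<Rightarrow> bool" where
  "in_equilibrium \<Omega> \<mu> u \<longleftrightarrow> (\<forall>x\<in>\<Omega>. \<forall>i.
     (\<Sum>j\<in>UNIV. partial_deriv j (stress \<mu> u i j) x) -
     (\<Sum>j\<in>UNIV. \<Sum>k\<in>UNIV. partial_deriv k (partial_deriv j (hyper_stress \<mu> u i j k)) x) = 0)"

definition universal_for :: "(real^3) set \<Rightarrow> material set \<Rightarrow> (real^3 \<Rightarrow> real^3) \<Rightarrow> bool" where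
  "universal_for \<Omega> K u \<longleftrightarrow> (\<forall>\<mu>\<in>K. in_equilibrium \<Omega> \<mu> u)"


section \<open>Symmetry groups and invariance\<close>

definition O3 :: "(real^3^3) monoid" where
  "O3 = \<lparr>carrier = {Q. orthogonal_matrix Q}, mult = (**), one = mat 1\<rparr>"

definition rotation_e2 :: "real \<Rightarrow> real^3^3" where
  "rotation_e2 \<theta> = vector [vector [cos \<theta>, 0, sin \<theta>],
                           vector [0, 1, 0],
                           vector [- sin \<theta>, 0, cos \<theta>]]"

definition rotation_e3 :: "real \<Rightarrow> real^3^3" where
  "rotation_e3 \<theta> = vector [vector [cos \<theta>, - sin \<theta>, 0],
                           vector [sin \<theta>, cos \<theta>, 0],
                           vector [0, 0, 1]]"

definition D3 :: "(real^3^3) set" where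
  "D3 = generate O3 {rotation_e3 (2 * pi / 3), rotation_e2 pi}"

definition D3_Z2c :: "(real^3^3) set" where
  "D3_Z2c = generate O3 (D3 \<union> {- mat 1})"

definition invariant4 :: "(real^3^3) set \<Rightarrow> tensor4 \<Rightarrow> bool" where
  "invariant4 G T \<longleftrightarrow> (\<forall>Q\<in>G. \<forall>i1 i2 i3 i4.
     (\<Sum>j1\<in>UNIV. \<Sum>j2\<in>UNIV. \<Sum>j3\<in>UNIV. \<Sum>j4\<in>UNIV.
        Q$i1$j1 * Q$i2$j2 * Q$i3$j3 * Q$i4$j4 * T j1 j2 j3 j4) = T i1 i2 i3 i4)"

definition invariant6 :: "(real^3^3) set \<Rightarrow> tensor6 \<Rightarrow> bool" where
  "invariant6 G T \<longleftrightarrow> (\<forall>Q\<in>G. \<forall>i1 i2 i3 i4 i5 i6.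
     (\<Sum>j1\<in>UNIV. \<Sum>j2\<in>UNIV. \<Sum>j3\<in>UNIV. \<Sum>j4\<in>UNIV. \<Sum>j5\<in>UNIV. \<Sum>j6\<in>UNIV.
        Q$i1$j1 * Q$i2$j2 * Q$i3$j3 * Q$i4$j4 * Q$i5$j5 * Q$i6$j6 * T j1 j2 j3 j4 j5 j6)
     = T i1 i2 i3 i4 i5 i6)"

definition trigonal_class :: "material set" where
  "trigonal_class = {(C, M, A) \<in> strain_gradient_materials.
     invariant4 D3_Z2c C \<and> M = (\<lambda>_ _ _ _ _. 0) \<and> invariant6 D3_Z2c A}"

end

theory Submission
  imports Defs
begin

text \<open>
  The elasticity tensors of the class form a six-parameter family. Testing the equilibrium
  equations with \<open>A = 0\<close> on this family turns universality into linear relations that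
  express all second derivatives of \<open>u\<close> at a point by the four numbers
  \<open>p = u\<^sub>1\<^sub>,\<^sub>1\<^sub>2\<close>, \<open>q = u\<^sub>1\<^sub>,\<^sub>1\<^sub>3\<close>, \<open>r = u\<^sub>1\<^sub>,\<^sub>2\<^sub>3\<close>, \<open>s = u\<^sub>2\<^sub>,\<^sub>1\<^sub>3\<close>.
  Symmetry of the third derivatives leaves a single third derivative \<open>p\<^sub>,\<^sub>3\<close>, which is
  constant, so \<open>p\<close>, \<open>q\<close>, \<open>r\<close>, \<open>s\<close> are affine and integrating twice yields the asserted
  polynomials. Conversely, for these fields the strain gradient is affine, hence the hyper-stress
  of every sixth-order tensor \<open>A\<close> has vanishing second derivatives.
\<close>

section \<open>Partial derivatives of smooth functions\<close>

text \<open>Openness makes the Frechet derivative at a point of \<open>S\<close> depend only on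
  values in \<open>S\<close>. This matters because \<open>Ck_on\<close> recurses through total
  functions that are controlled on \<open>S\<close> only.\<close>

lemma Ck_on_cong:
  assumes "open S" "\<And>x. x \<in> S \<Longrightarrow> f x = g x" "Ck_on k S f"
  shows "Ck_on k S g"
  using assms(2,3)
proof (induction k arbitrary: f g)
  case 0
  then show ?case using continuous_on_cong[of S S f g] by simp
next
  case (Suc k)
  have D: "(g has_derivative frechet_derivative f (at x)) (at x)" if "x \<in> S" for x
    using that Suc.prems assms(1) frechet_derivative_works[of f "at x"]
    by (auto intro: has_derivative_transform_within_open)
  have "frechet_derivative f (at x) v = frechet_derivative g (at x) v" if "x \<in> S" for x v
    using frechet_derivative_at[OF D[OF that]] by simp
  then have "Ck_on k S (\<lambda>x. frechet_derivative g (at x) v)" for v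
    using Suc.IH[of "\<lambda>x. frechet_derivative f (at x) v" "\<lambda>x. frechet_derivative g (at x) v"] Suc.prems
    by simp
  moreover have "g differentiable (at x)" if "x \<in> S" for x
    using D[OF that] by (auto simp: differentiable_def)
  ultimately show ?case by simp
qed

lemma smooth_on_cong:
  "\<lbrakk>open S; \<And>x. x \<in> S \<Longrightarrow> f x = g x; smooth_on S f\<rbrakk> \<Longrightarrow> smooth_on S g"
  unfolding smooth_on_def using Ck_on_cong by blast

text \<open>A bounded linear map commutes with differentiation; the resulting identity holds on
  \<open>S\<close> only, hence the appeal to \<open>Ck_on_cong\<close>.\<close>

lemma Ck_on_bounded_linear:
  assumes "open S" "bounded_linear h" "Ck_on k S f"
  shows "Ck_on k S (\<lambda>x. h (f x))"
  using assms(3)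
proof (induction k arbitrary: f)
  case 0
  then show ?case by (simp add: bounded_linear.continuous_on[OF assms(2)])
next
  case (Suc k)
  have D: "((\<lambda>x. h (f x)) has_derivative (\<lambda>v. h (frechet_derivative f (at x) v))) (at x)"
    if "x \<in> S" for x
    using that Suc.prems frechet_derivative_works[of f "at x"]
    by (intro bounded_linear.has_derivative[OF assms(2)]) auto
  have "Ck_on k S (\<lambda>x. frechet_derivative (\<lambda>x. h (f x)) (at x) v)" for v
    by (rule Ck_on_cong[OF assms(1), where f = "\<lambda>x. h (frechet_derivative f (at x) v)"])
      (use Suc frechet_derivative_at[OF D] in \<open>auto simp: fun_eq_iff\<close>)
  moreover have "(\<lambda>x. h (f x)) differentiable (at x)" if "x \<in> S" for x
    using D[OF that] by (auto simp: differentiable_def)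
  ultimately show ?case by simp
qed

lemma smooth_on_component: "\<lbrakk>open S; smooth_on S f\<rbrakk> \<Longrightarrow> smooth_on S (\<lambda>x. f x $ i)"
  unfolding smooth_on_def using Ck_on_bounded_linear[OF _ bounded_linear_vec_nth] by blast

lemma smooth_on_differentiable: "\<lbrakk>smooth_on S f; x \<in> S\<rbrakk> \<Longrightarrow> f differentiable (at x)"
  unfolding smooth_on_def by (metis Ck_on.simps(2))

lemma smooth_on_continuous_on: "smooth_on S f \<Longrightarrow> continuous_on S f"
  unfolding smooth_on_def by (metis Ck_on.simps(1))

section \<open>Partial derivatives as one-variable derivatives\<close>

lemma DERIV_directional:
  assumes "(f has_derivative f') (at x)"
  shows "((\<lambda>t. f (x + t *\<^sub>R v)) has_real_derivative f' v) (at 0)"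
proof -
  have "((\<lambda>t. f (x + t *\<^sub>R v)) has_derivative (\<lambda>t. f' (t *\<^sub>R v))) (at 0)"
    by (rule has_derivative_compose[where f = "\<lambda>t. x + t *\<^sub>R v" and g = f])
       (use assms in \<open>auto intro!: derivative_eq_intros\<close>)
  moreover have "f' (t *\<^sub>R v) = f' v * t" for t
    using has_derivative_linear[OF assms] by (simp add: linear_scale)
  ultimately show ?thesis by (simp add: has_field_derivative_def)
qed

lemma partial_deriv_eq:
  "(f has_derivative f') (at x) \<Longrightarrow> partial_deriv k f x = f' (axis k 1)"
  unfolding partial_deriv_def by (intro DERIV_imp_deriv DERIV_directional)

lemma partial_deriv_cong:
  assumes "open S" "x \<in> S" "\<And>y. y \<in> S \<Longrightarrow> f y = g y"
  shows "partial_deriv k f x = partial_deriv k g x"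
  unfolding partial_deriv_def
proof (rule deriv_cong_ev)
  have "open ((\<lambda>t. x + t *\<^sub>R axis k 1) -` S :: real set)"
    using assms(1) by (intro open_vimage continuous_intros)
  then have "eventually (\<lambda>t. t \<in> (\<lambda>t. x + t *\<^sub>R axis k 1) -` S) (nhds (0 :: real))"
    using assms(2) by (intro eventually_nhds_in_open) auto
  then show "\<forall>\<^sub>F t in nhds 0. f (x + t *\<^sub>R axis k 1) = g (x + t *\<^sub>R axis k 1)"
    by eventually_elim (use assms(3) in auto)
qed simp

lemma partial_deriv_frechet:
  "f differentiable (at x) \<Longrightarrow> partial_deriv k f x = frechet_derivative f (at x) (axis k 1)"
  by (simp add: frechet_derivative_works partial_deriv_eq)

text \<open>On \<open>S\<close> a partial derivative is the Frechet derivative in a fixed direction,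
  and \<open>Ck_on (Suc n)\<close> asserts \<open>Ck_on n\<close> for exactly that function.\<close>

lemma smooth_on_partial_deriv:
  assumes "open S" "smooth_on S f"
  shows "smooth_on S (partial_deriv k f)"
proof (rule smooth_on_cong[OF assms(1)])
  show "smooth_on S (\<lambda>x. frechet_derivative f (at x) (axis k 1))"
    unfolding smooth_on_def
  proof
    fix n
    have "Ck_on (Suc n) S f" using assms(2) unfolding smooth_on_def by blast
    then show "Ck_on n S (\<lambda>x. frechet_derivative f (at x) (axis k 1))" by simp
  qed
qed (simp add: partial_deriv_frechet smooth_on_differentiable[OF assms(2)])

lemma DERIV_partial:
  assumes "f differentiable (at x)"
  shows "((\<lambda>t. f (x + t *\<^sub>R axis k 1)) has_real_derivative partial_deriv k f x) (at 0)"
  unfolding partial_deriv_frechet[OF assms]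
  by (intro DERIV_directional) (use assms in \<open>simp add: frechet_derivative_works\<close>)

lemma partial_deriv_add:
  assumes "f differentiable (at x)" "g differentiable (at x)"
  shows "partial_deriv k (\<lambda>y. f y + g y) x = partial_deriv k f x + partial_deriv k g x"
  unfolding partial_deriv_def[of k "\<lambda>y. f y + g y"]
  by (intro DERIV_imp_deriv DERIV_add DERIV_partial assms)

lemma partial_deriv_cmult:
  assumes "f differentiable (at x)"
  shows "partial_deriv k (\<lambda>y. c * f y) x = c * partial_deriv k f x"
  unfolding partial_deriv_def[of k "\<lambda>y. c * f y"]
  by (intro DERIV_imp_deriv DERIV_cmult DERIV_partial assms)

lemma partial_deriv_sum:
  assumes "\<And>a. a \<in> A \<Longrightarrow> f a differentiable (at x)"
  shows "partial_deriv k (\<lambda>y. \<Sum>a\<in>A. f a y) x = (\<Sum>a\<in>A. partial_deriv k (f a) x)"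
  unfolding partial_deriv_def[of k "\<lambda>y. \<Sum>a\<in>A. f a y"]
  by (intro DERIV_imp_deriv DERIV_sum DERIV_partial assms)

section \<open>Symmetry of mixed derivatives\<close>

lemma DERIV_directional_shift:
  fixes f :: "'a::real_normed_vector \<Rightarrow> real"
  assumes "((\<lambda>s. f (x + t *\<^sub>R v + s *\<^sub>R v)) has_real_derivative D) (at 0)"
  shows "((\<lambda>s. f (x + s *\<^sub>R v)) has_real_derivative D) (at t)"
proof -
  have "((\<lambda>s. f (x + (t + s) *\<^sub>R v)) has_real_derivative D) (at 0)"
    using assms by (simp add: scaleR_add_left algebra_simps)
  then show ?thesis using DERIV_shift[of "\<lambda>s. f (x + s *\<^sub>R v)" D 0 t] by (simp add: add.commute)
qed

text \<open>The mean value theorem is applied twice: in direction \<open>v\<close> to the increment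
  of \<open>f\<close> along \<open>h *\<^sub>R w\<close>, then in direction \<open>w\<close> to
  \<open>fv\<close>.\<close>

lemma second_difference_mean_value:
  fixes f :: "'a::real_normed_vector \<Rightarrow> real"
  assumes "0 < h"
    and S: "\<And>s t. \<lbrakk>0 \<le> s; s \<le> h; 0 \<le> t; t \<le> h\<rbrakk> \<Longrightarrow> x + s *\<^sub>R v + t *\<^sub>R w \<in> S"
    and fv: "\<And>y. y \<in> S \<Longrightarrow> ((\<lambda>t. f (y + t *\<^sub>R v)) has_real_derivative fv y) (at 0)"
    and fvw: "\<And>y. y \<in> S \<Longrightarrow> ((\<lambda>t. fv (y + t *\<^sub>R w)) has_real_derivative fvw y) (at 0)"
  shows "\<exists>s t. 0 < s \<and> s < h \<and> 0 < t \<and> t < h \<and>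
     f (x + h *\<^sub>R v + h *\<^sub>R w) - f (x + h *\<^sub>R v) - f (x + h *\<^sub>R w) + f x
       = h * h * fvw (x + s *\<^sub>R v + t *\<^sub>R w)"
proof -
  define \<phi> where "\<phi> s = f (x + h *\<^sub>R w + s *\<^sub>R v) - f (x + s *\<^sub>R v)" for s
  have \<phi>': "(\<phi> has_real_derivative fv (x + h *\<^sub>R w + s *\<^sub>R v) - fv (x + s *\<^sub>R v)) (at s)"
    if "0 \<le> s" "s \<le> h" for s
  proof -
    have "x + h *\<^sub>R w + s *\<^sub>R v \<in> S" "x + s *\<^sub>R v \<in> S"
      using S[of s h] S[of s 0] that assms(1) by (simp_all add: ac_simps)
    then show ?thesis
      unfolding \<phi>_def by (intro DERIV_diff DERIV_directional_shift[OF fv])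
  qed
  from MVT2[OF assms(1) \<phi>'] obtain s where s: "0 < s" "s < h"
    "\<phi> h - \<phi> 0 = h * (fv (x + h *\<^sub>R w + s *\<^sub>R v) - fv (x + s *\<^sub>R v))"
    by auto
  define \<psi> where "\<psi> t = fv (x + s *\<^sub>R v + t *\<^sub>R w)" for t
  have \<psi>': "(\<psi> has_real_derivative fvw (x + s *\<^sub>R v + t *\<^sub>R w)) (at t)"
    if "0 \<le> t" "t \<le> h" for t
    unfolding \<psi>_def
    by (intro DERIV_directional_shift[OF fvw] S that less_imp_le s)
  from MVT2[OF assms(1) \<psi>'] obtain t where t: "0 < t" "t < h"
    "\<psi> h - \<psi> 0 = h * fvw (x + s *\<^sub>R v + t *\<^sub>R w)"
    by auto
  have "f (x + h *\<^sub>R v + h *\<^sub>R w) - f (x + h *\<^sub>R v) - f (x + h *\<^sub>R w) + f x = \<phi> h - \<phi> 0"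
    by (simp add: \<phi>_def algebra_simps)
  also have "\<dots> = h * (\<psi> h - \<psi> 0)" using s(3) by (simp add: \<psi>_def algebra_simps)
  finally show ?thesis using s t by (auto simp: mult.assoc)
qed

text \<open>Schwarz's theorem. The second difference over a small parallelogram is symmetric in
  \<open>v\<close> and \<open>w\<close>, so it is \<open>h * h\<close> times a nearby value of
  \<open>fvw\<close> and also of \<open>fwv\<close>; continuity then excludes a gap at
  \<open>x\<close>.\<close>

lemma mixed_directional_derivs_eq:
  fixes f :: "'a::real_normed_vector \<Rightarrow> real"
  assumes "open S" "x \<in> S"
    and fv: "\<And>y. y \<in> S \<Longrightarrow> ((\<lambda>t. f (y + t *\<^sub>R v)) has_real_derivative fv y) (at 0)"
    and fw: "\<And>y. y \<in> S \<Longrightarrow> ((\<lambda>t. f (y + t *\<^sub>R w)) has_real_derivative fw y) (at 0)"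
    and fvw: "\<And>y. y \<in> S \<Longrightarrow> ((\<lambda>t. fv (y + t *\<^sub>R w)) has_real_derivative fvw y) (at 0)"
    and fwv: "\<And>y. y \<in> S \<Longrightarrow> ((\<lambda>t. fw (y + t *\<^sub>R v)) has_real_derivative fwv y) (at 0)"
    and cont: "continuous_on S fvw" "continuous_on S fwv"
  shows "fvw x = fwv x"
proof (rule ccontr)
  assume "fvw x \<noteq> fwv x"
  \<comment> \<open>Half the gap, so that no number lies within \<open>e\<close> of both
    \<open>fvw x\<close> and \<open>fwv x\<close>.\<close>
  define e where "e = \<bar>fvw x - fwv x\<bar> / 2"
  have "e > 0" using \<open>fvw x \<noteq> fwv x\<close> by (simp add: e_def)
  obtain r where r: "r > 0" "ball x r \<subseteq> S" using assms(1,2) openE by blast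
  obtain r1 where r1: "r1 > 0" "\<And>y. \<lbrakk>y \<in> S; dist y x < r1\<rbrakk> \<Longrightarrow> dist (fvw y) (fvw x) < e"
    using cont(1) \<open>x \<in> S\<close> \<open>e > 0\<close> unfolding continuous_on_iff by blast
  obtain r2 where r2: "r2 > 0" "\<And>y. \<lbrakk>y \<in> S; dist y x < r2\<rbrakk> \<Longrightarrow> dist (fwv y) (fwv x) < e"
    using cont(2) \<open>x \<in> S\<close> \<open>e > 0\<close> unfolding continuous_on_iff by blast
  define d where "d = min r (min r1 r2)"
  \<comment> \<open>The summand \<open>1\<close> keeps \<open>c\<close> positive even if both
    directions vanish; with the \<open>h\<close> below, the parallelogram stays within
    \<open>d / 2\<close> of \<open>x\<close>.\<close>
  define c where "c = norm v + norm w + 1"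
  define h where "h = d / (2 * c)"
  have "d > 0" using r r1 r2 by (simp add: d_def)
  moreover have "c > 0" unfolding c_def by (intro add_nonneg_pos) auto
  ultimately have "h > 0" by (simp add: h_def)
  have near: "dist (x + s *\<^sub>R v + t *\<^sub>R w) x < d" if "0 \<le> s" "s \<le> h" "0 \<le> t" "t \<le> h" for s t
  proof -
    have "dist (x + s *\<^sub>R v + t *\<^sub>R w) x = norm (s *\<^sub>R v + t *\<^sub>R w)"
      by (simp add: dist_norm algebra_simps)
    also have "\<dots> \<le> s * norm v + t * norm w"
      using norm_triangle_ineq[of "s *\<^sub>R v" "t *\<^sub>R w"] that by simp
    also have "\<dots> \<le> h * norm v + h * norm w"
      using that by (intro add_mono mult_right_mono) auto
    also have "\<dots> \<le> h * c"
      using \<open>h > 0\<close> by (simp add: c_def algebra_simps)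
    also have "\<dots> = d / 2"
      using \<open>c > 0\<close> by (simp add: h_def)
    finally show ?thesis using \<open>d > 0\<close> by linarith
  qed
  have inS: "x + s *\<^sub>R v + t *\<^sub>R w \<in> S" if "0 \<le> s" "s \<le> h" "0 \<le> t" "t \<le> h" for s t
    using near[OF that] r(2) by (auto simp: d_def dist_commute)
  obtain s t where st: "0 < s" "s < h" "0 < t" "t < h"
     "f (x + h *\<^sub>R v + h *\<^sub>R w) - f (x + h *\<^sub>R v) - f (x + h *\<^sub>R w) + f x
       = h * h * fvw (x + s *\<^sub>R v + t *\<^sub>R w)"
    using second_difference_mean_value[OF \<open>h > 0\<close> inS fv fvw] by blast
  have inS': "x + t *\<^sub>R w + s *\<^sub>R v \<in> S" if "0 \<le> t" "t \<le> h" "0 \<le> s" "s \<le> h" for s t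
    using inS[of s t] that by (simp add: algebra_simps)
  obtain s' t' where st': "0 < s'" "s' < h" "0 < t'" "t' < h"
     "f (x + h *\<^sub>R w + h *\<^sub>R v) - f (x + h *\<^sub>R w) - f (x + h *\<^sub>R v) + f x
       = h * h * fwv (x + t' *\<^sub>R w + s' *\<^sub>R v)"
    using second_difference_mean_value[OF \<open>h > 0\<close> inS' fw fwv] by blast
  have "h * h * fvw (x + s *\<^sub>R v + t *\<^sub>R w) = h * h * fwv (x + s' *\<^sub>R v + t' *\<^sub>R w)"
    using st(5) st'(5) by (simp add: algebra_simps)
  then have "fvw (x + s *\<^sub>R v + t *\<^sub>R w) = fwv (x + s' *\<^sub>R v + t' *\<^sub>R w)"
    using \<open>h > 0\<close> by simp
  moreover have "dist (fvw (x + s *\<^sub>R v + t *\<^sub>R w)) (fvw x) < e"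
    using near[of s t] inS[of s t] st r1 by (auto simp: d_def)
  moreover have "dist (fwv (x + s' *\<^sub>R v + t' *\<^sub>R w)) (fwv x) < e"
    using near[of s' t'] inS[of s' t'] st' r2 by (auto simp: d_def)
  ultimately show False unfolding e_def dist_real_def by (auto simp: abs_if split: if_splits)
qed

lemma partial_deriv_commute:
  assumes "open S" "smooth_on S f" "x \<in> S"
  shows "partial_deriv j (partial_deriv k f) x = partial_deriv k (partial_deriv j f) x"
proof -
  note sm = smooth_on_partial_deriv[OF assms(1)]
  show ?thesis
    by (rule mixed_directional_derivs_eq[OF assms(1,3), where f = f
            and v = "axis k 1" and w = "axis j 1"])
       (auto intro!: DERIV_partial smooth_on_continuous_on intro: smooth_on_differentiable sm assms)
qed

section \<open>Recovering a function from its derivatives\<close>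

text \<open>A linear map is determined on the basis, so the difference has derivative zero;
  convexity of the domain makes it constant.\<close>

lemma equal_partial_derivs_imp_differ_by_constant:
  assumes "open S" "convex S"
    and "\<And>x. x \<in> S \<Longrightarrow> f differentiable (at x)" "\<And>x. x \<in> S \<Longrightarrow> g differentiable (at x)"
    and eq: "\<And>x k. x \<in> S \<Longrightarrow> partial_deriv k f x = partial_deriv k g x"
  shows "\<exists>c. \<forall>x\<in>S. f x = g x + c"
proof -
  have "((\<lambda>x. f x - g x) has_derivative (\<lambda>h. 0)) (at x within S)" if "x \<in> S" for x
  proof -
    note diff = assms(3)[OF that] assms(4)[OF that]
    note D = diff[unfolded frechet_derivative_works]
    have "frechet_derivative f (at x) (axis k 1) = frechet_derivative g (at x) (axis k 1)" for k
      using eq[OF that] diff by (simp add: partial_deriv_frechet)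
    then have "frechet_derivative f (at x) = frechet_derivative g (at x)"
      using D by (intro linear_eq_stdbasis) (auto simp: has_derivative_linear Basis_vec_def)
    then show ?thesis
      using has_derivative_diff[OF D] by (simp add: has_derivative_at_withinI)
  qed
  from has_derivative_zero_constant[OF assms(2) this] obtain c where "\<forall>x\<in>S. f x - g x = c"
    by blast
  then show ?thesis by (intro exI[of _ c]) (auto simp: algebra_simps)
qed

section \<open>Differentiation rules for polynomials\<close>

lemma differentiable_nth: "(\<lambda>x. x $ i) differentiable F"
  by (rule bounded_linear_imp_differentiable[OF bounded_linear_vec_nth])

lemma partial_deriv_const: "partial_deriv k (\<lambda>_. c) x = 0"
  by (simp add: partial_deriv_def)

lemma partial_deriv_nth: "partial_deriv k (\<lambda>x. x $ i) x = (if k = i then 1 else 0)"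
  by (subst partial_deriv_eq[OF bounded_linear_imp_has_derivative[OF bounded_linear_vec_nth]])
     (simp add: axis_def)

lemma partial_deriv_inner: "partial_deriv k (\<lambda>x. v \<bullet> x) x = v $ k"
  by (subst partial_deriv_eq[OF bounded_linear_imp_has_derivative[OF bounded_linear_inner_right]])
     (simp add: inner_axis)

lemma differentiable_inner_const: "(\<lambda>x. v \<bullet> x) differentiable F"
  by (rule bounded_linear_imp_differentiable[OF bounded_linear_inner_right])

lemma partial_deriv_mult:
  assumes "f differentiable (at x)" "g differentiable (at x)"
  shows "partial_deriv k (\<lambda>y. f y * g y) x = partial_deriv k f x * g x + f x * partial_deriv k g x"
  unfolding partial_deriv_def[of k "\<lambda>y. f y * g y"]
  using DERIV_mult[OF DERIV_partial[OF assms(1)] DERIV_partial[OF assms(2)], of k k]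
  by (intro DERIV_imp_deriv) (simp add: ac_simps)

lemma partial_deriv_diff:
  assumes "f differentiable (at x)" "g differentiable (at x)"
  shows "partial_deriv k (\<lambda>y. f y - g y) x = partial_deriv k f x - partial_deriv k g x"
  unfolding partial_deriv_def[of k "\<lambda>y. f y - g y"]
  by (intro DERIV_imp_deriv DERIV_diff DERIV_partial assms)

lemma partial_deriv_minus:
  "f differentiable (at x) \<Longrightarrow> partial_deriv k (\<lambda>y. - f y) x = - partial_deriv k f x"
  using partial_deriv_cmult[of f x k "-1"] by simp

lemma differentiable_divide_const:
  fixes f :: "real^3 \<Rightarrow> real"
  assumes "f differentiable (at x)"
  shows "(\<lambda>y. f y / c) differentiable (at x)"
  using differentiable_mult[OF differentiable_const assms, of "inverse c"]
  by (simp add: divide_inverse mult.commute)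

lemma partial_deriv_divide_const:
  assumes "f differentiable (at x)"
  shows "partial_deriv k (\<lambda>y. f y / c) x = partial_deriv k f x / c"
  using partial_deriv_cmult[OF assms, of k "inverse c"] by (simp add: divide_inverse mult.commute)

text \<open>The forward direction integrates twice: the first partial derivatives differ by
  constants, which form the vector \<open>v\<close>, and removing the linear function
  \<open>v \<bullet> x\<close> leaves a constant.\<close>

lemma second_partials_eq_iff:
  assumes "open S" "convex S" "smooth_on S f"
    and g: "\<And>x. g differentiable (at x)" "\<And>k x. partial_deriv k g differentiable (at x)"
  shows "(\<forall>x\<in>S. \<forall>j k. partial_deriv j (partial_deriv k f) x = partial_deriv j (partial_deriv k g) x)
    \<longleftrightarrow> (\<exists>v c. \<forall>x\<in>S. f x = g x + v \<bullet> x + c)" (is "?L \<longleftrightarrow> ?R")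
proof
  assume ?L
  note df = smooth_on_differentiable[OF assms(3)]
    smooth_on_differentiable[OF smooth_on_partial_deriv[OF assms(1,3)]]
  have "\<exists>c. \<forall>x\<in>S. partial_deriv k f x = partial_deriv k g x + c" for k
    using \<open>?L\<close> df g by (intro equal_partial_derivs_imp_differ_by_constant assms) auto
  then obtain v where v: "\<And>k x. x \<in> S \<Longrightarrow> partial_deriv k f x = partial_deriv k g x + v k"
    by metis
  have "\<exists>c. \<forall>x\<in>S. f x = (g x + (\<chi> k. v k) \<bullet> x) + c"
    by (intro equal_partial_derivs_imp_differ_by_constant assms df)
       (simp_all add: g differentiable_inner_const partial_deriv_add partial_deriv_inner v)
  then show ?R by blast
next
  assume ?R
  then obtain v c where fg: "\<And>x. x \<in> S \<Longrightarrow> f x = g x + v \<bullet> x + c" by blast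
  have "partial_deriv k f x = partial_deriv k g x + v $ k" if "x \<in> S" for k x
    by (subst partial_deriv_cong[OF assms(1) that fg])
       (simp_all add: g differentiable_inner_const partial_deriv_add partial_deriv_inner partial_deriv_const)
  then have "partial_deriv j (partial_deriv k f) x = partial_deriv j (\<lambda>x. partial_deriv k g x + v $ k) x"
    if "x \<in> S" for j k x
    by (intro partial_deriv_cong[OF assms(1) that])
  then show ?L by (simp add: g partial_deriv_add partial_deriv_const)
qed

section \<open>Affine functions\<close>

definition affine_function_on :: "(real^3) set \<Rightarrow> (real^3 \<Rightarrow> real) \<Rightarrow> bool" where
  "affine_function_on S f \<longleftrightarrow> (\<exists>v c. \<forall>x\<in>S. f x = v \<bullet> x + c)"

lemma affine_function_on_nth: "affine_function_on S (\<lambda>x. a * x $ i + c)"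
  unfolding affine_function_on_def
  by (intro exI[of _ "axis i a"] exI[of _ c]) (simp add: inner_axis' )

lemma affine_function_on_add:
  assumes "affine_function_on S f" "affine_function_on S g"
  shows "affine_function_on S (\<lambda>x. f x + g x)"
proof -
  obtain v c w d where "\<forall>x\<in>S. f x = v \<bullet> x + c" "\<forall>x\<in>S. g x = w \<bullet> x + d"
    using assms unfolding affine_function_on_def by blast
  then have "\<forall>x\<in>S. f x + g x = (v + w) \<bullet> x + (c + d)" by (simp add: inner_add_left)
  then show ?thesis unfolding affine_function_on_def by blast
qed

lemma affine_function_on_cmult:
  assumes "affine_function_on S f"
  shows "affine_function_on S (\<lambda>x. a * f x)"
proof -
  obtain v c where "\<forall>x\<in>S. f x = v \<bullet> x + c"
    using assms unfolding affine_function_on_def by blast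
  then have "\<forall>x\<in>S. a * f x = (a *\<^sub>R v) \<bullet> x + a * c" by (simp add: distrib_left)
  then show ?thesis unfolding affine_function_on_def by blast
qed

lemma affine_function_on_const: "affine_function_on S (\<lambda>x. c)"
  using affine_function_on_nth[of S 0 1 c] by simp

lemma affine_function_on_sum:
  assumes "finite A" "\<And>a. a \<in> A \<Longrightarrow> affine_function_on S (f a)"
  shows "affine_function_on S (\<lambda>x. \<Sum>a\<in>A. f a x)"
  using assms by induction (auto intro: affine_function_on_add affine_function_on_const)

lemma affine_function_on_cong:
  "\<lbrakk>affine_function_on S f; \<And>x. x \<in> S \<Longrightarrow> f x = g x\<rbrakk> \<Longrightarrow> affine_function_on S g"
  unfolding affine_function_on_def by auto

lemma second_partials_affine:
  assumes "open S" "affine_function_on S f" "x \<in> S"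
  shows "partial_deriv j (partial_deriv k f) x = 0"
proof -
  obtain v c where f: "\<And>x. x \<in> S \<Longrightarrow> f x = v \<bullet> x + c"
    using assms(2) unfolding affine_function_on_def by blast
  have "partial_deriv k f y = v $ k" if "y \<in> S" for y
    by (subst partial_deriv_cong[OF assms(1) that f])
       (simp_all add: differentiable_inner_const partial_deriv_add partial_deriv_inner partial_deriv_const)
  then show ?thesis
    using partial_deriv_cong[OF assms(1,3), of "partial_deriv k f" "\<lambda>_. v $ k"]
    by (simp add: partial_deriv_const)
qed

section \<open>Trigonal elasticity tensors\<close>

type_synonym bilinear_form3 = "real^3 \<Rightarrow> real^3 \<Rightarrow> real"

definition plane_trace :: bilinear_form3 where
  "plane_trace x y = x$1 * y$1 + x$2 * y$2"
definition axial_part :: bilinear_form3 where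
  "axial_part x y = x$3 * y$3"
definition plane_shear1 :: bilinear_form3 where
  "plane_shear1 x y = x$1 * y$1 - x$2 * y$2"
definition plane_shear2 :: bilinear_form3 where
  "plane_shear2 x y = x$1 * y$2 + x$2 * y$1"
definition axial_shear1 :: bilinear_form3 where
  "axial_shear1 x y = x$1 * y$3 + x$3 * y$1"
definition axial_shear2 :: bilinear_form3 where
  "axial_shear2 x y = x$2 * y$3 + x$3 * y$2"

lemmas bilinear_form_defs = plane_trace_def axial_part_def plane_shear1_def plane_shear2_def
  axial_shear1_def axial_shear2_def

text \<open>For symmetric matrices \<open>e\<close>, pairing \<open>e\<close> with the first two forms gives
  \<open>e\<^sub>1\<^sub>1 + e\<^sub>2\<^sub>2\<close> and \<open>e\<^sub>3\<^sub>3\<close>, which the rotations about \<open>e\<^sub>3\<close> fix; a rotation by \<open>\<theta>\<close> turns the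
  plane shears by \<open>2\<theta>\<close> and the axial shears by \<open>\<theta>\<close>. The last term of the following form mixes the
  two and is invariant only because \<open>3\<theta> = 2\<pi>\<close>.\<close>

definition trigonal_form ::
  "real \<Rightarrow> real \<Rightarrow> real \<Rightarrow> real \<Rightarrow> real \<Rightarrow> real \<Rightarrow> real^3 \<Rightarrow> real^3 \<Rightarrow> real^3 \<Rightarrow> real^3 \<Rightarrow> real" where
  "trigonal_form \<alpha> \<beta> \<gamma> \<delta> \<epsilon> \<zeta> x y z w =
     \<alpha> * (plane_trace x y * plane_trace z w)
   + \<beta> * (plane_trace x y * axial_part z w + axial_part x y * plane_trace z w)
   + \<gamma> * (axial_part x y * axial_part z w)
   + \<delta> * (axial_shear1 x y * axial_shear1 z w + axial_shear2 x y * axial_shear2 z w)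
   + \<epsilon> * (plane_shear1 x y * plane_shear1 z w + plane_shear2 x y * plane_shear2 z w)
   + \<zeta> * ((plane_shear1 x y * axial_shear1 z w - plane_shear2 x y * axial_shear2 z w)
        + (axial_shear1 x y * plane_shear1 z w - axial_shear2 x y * plane_shear2 z w))"

definition trigonal_tensor :: "real \<Rightarrow> real \<Rightarrow> real \<Rightarrow> real \<Rightarrow> real \<Rightarrow> real \<Rightarrow> tensor4" where
  "trigonal_tensor \<alpha> \<beta> \<gamma> \<delta> \<epsilon> \<zeta> i j l m =
     trigonal_form \<alpha> \<beta> \<gamma> \<delta> \<epsilon> \<zeta> (axis i 1) (axis j 1) (axis l 1) (axis m 1)"

text \<open>Row vectors are multiplied from the right because \<open>axis i 1 v* Q\<close> is row
  \<open>i\<close> of \<open>Q\<close>: on basis vectors the condition becomes the index contraction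
  of \<open>invariant4\<close>.\<close>

definition preserves_form :: "(real^3 \<Rightarrow> real^3 \<Rightarrow> real^3 \<Rightarrow> real^3 \<Rightarrow> real) \<Rightarrow> real^3^3 \<Rightarrow> bool" where
  "preserves_form F Q \<longleftrightarrow> (\<forall>x y z w. F (x v* Q) (y v* Q) (z v* Q) (w v* Q) = F x y z w)"

section \<open>Invariance under generated groups\<close>

lemma inv_O3:
  assumes "orthogonal_matrix Q"
  shows "inv\<^bsub>O3\<^esub> Q = transpose Q"
  unfolding m_inv_def
proof (rule the_equality)
  show "transpose Q \<in> carrier O3 \<and> Q \<otimes>\<^bsub>O3\<^esub> transpose Q = \<one>\<^bsub>O3\<^esub> \<and> transpose Q \<otimes>\<^bsub>O3\<^esub> Q = \<one>\<^bsub>O3\<^esub>"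
    using assms by (simp add: O3_def orthogonal_matrix_def)
next
  fix R assume "R \<in> carrier O3 \<and> Q \<otimes>\<^bsub>O3\<^esub> R = \<one>\<^bsub>O3\<^esub> \<and> R \<otimes>\<^bsub>O3\<^esub> Q = \<one>\<^bsub>O3\<^esub>"
  then have "Q ** R = mat 1" by (simp add: O3_def)
  then have "transpose Q ** (Q ** R) = transpose Q" by simp
  then show "R = transpose Q"
    using assms by (simp add: orthogonal_matrix_def matrix_mul_assoc)
qed

text \<open>Orthogonality is carried along because the lemma is applied twice: the elements of
  \<open>D3\<close> serve as generators of \<open>D3_Z2c\<close>, and the inverse of a generator is
  its transpose by \<open>inv_O3\<close>.\<close>

lemma preserves_form_generate:
  assumes "\<And>Q. Q \<in> H \<Longrightarrow> orthogonal_matrix Q \<and> preserves_form F Q"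
    and "Q \<in> generate O3 H"
  shows "orthogonal_matrix Q \<and> preserves_form F Q"
  using assms(2)
proof induction
  case one
  show ?case by (simp add: O3_def orthogonal_matrix_id preserves_form_def)
next
  case (incl Q)
  then show ?case using assms(1) by blast
next
  case (inv Q)
  then have Q: "orthogonal_matrix Q" "preserves_form F Q" using assms(1) by auto
  \<comment> \<open>\<open>Q\<close> undoes the action of \<open>transpose Q\<close>, so invariance
    under \<open>Q\<close>, read backwards, is invariance under its inverse.\<close>
  have "(x v* transpose Q) v* Q = x" for x
    unfolding vector_matrix_mul_assoc using Q(1) by (simp add: orthogonal_matrix_def)
  then have "preserves_form F (transpose Q)"
    using Q(2) unfolding preserves_form_def by metis
  then show ?case using Q(1) by (simp add: inv_O3)
next
  case (eng Q R)
  then have "preserves_form F (Q ** R)"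
    unfolding preserves_form_def vector_matrix_mul_assoc[symmetric] by simp
  then show ?case using eng by (simp add: O3_def orthogonal_matrix_mul)
qed

lemma vector_matrix_mult_3:
  "(x v* (Q :: real^3^3)) $ i = x$1 * Q$1$i + x$2 * Q$2$i + x$3 * Q$3$i"
  by (simp add: vector_matrix_mult_def sum_3 mult.commute)

lemma rotation_e3_120_nth:
  "rotation_e3 (2 * pi / 3) $ 1 $ 1 = -1/2" "rotation_e3 (2 * pi / 3) $ 1 $ 2 = - sqrt 3 / 2"
  "rotation_e3 (2 * pi / 3) $ 1 $ 3 = 0"
  "rotation_e3 (2 * pi / 3) $ 2 $ 1 = sqrt 3 / 2" "rotation_e3 (2 * pi / 3) $ 2 $ 2 = -1/2"
  "rotation_e3 (2 * pi / 3) $ 2 $ 3 = 0"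
  "rotation_e3 (2 * pi / 3) $ 3 $ 1 = 0" "rotation_e3 (2 * pi / 3) $ 3 $ 2 = 0"
  "rotation_e3 (2 * pi / 3) $ 3 $ 3 = 1"
  unfolding rotation_e3_def cos_120 sin_120 by simp_all

lemma rotation_e2_pi_nth:
  "rotation_e2 pi $ 1 $ 1 = -1" "rotation_e2 pi $ 1 $ 2 = 0" "rotation_e2 pi $ 1 $ 3 = 0"
  "rotation_e2 pi $ 2 $ 1 = 0" "rotation_e2 pi $ 2 $ 2 = 1" "rotation_e2 pi $ 2 $ 3 = 0"
  "rotation_e2 pi $ 3 $ 1 = 0" "rotation_e2 pi $ 3 $ 2 = 0" "rotation_e2 pi $ 3 $ 3 = -1"
  unfolding rotation_e2_def by simp_all

lemma orthogonal_rotation_e3_120: "orthogonal_matrix (rotation_e3 (2 * pi / 3))"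
  by (simp add: orthogonal_matrix vec_eq_iff forall_3 matrix_matrix_mult_def transpose_def sum_3
      rotation_e3_120_nth mat_def)

lemma orthogonal_rotation_e2_pi: "orthogonal_matrix (rotation_e2 pi)"
  by (simp add: orthogonal_matrix vec_eq_iff forall_3 matrix_matrix_mult_def transpose_def sum_3
      rotation_e2_pi_nth mat_def)

text \<open>This rotation negates the first and third coordinates. Only \<open>plane_shear2\<close>
  and \<open>axial_shear2\<close> change sign, and \<open>trigonal_form\<close> contains them in
  pairs.\<close>

lemma preserves_form_rotation_e2: "preserves_form (trigonal_form \<alpha> \<beta> \<gamma> \<delta> \<epsilon> \<zeta>) (rotation_e2 pi)"
proof -
  have "plane_trace (x v* rotation_e2 pi) (y v* rotation_e2 pi) = plane_trace x y"
    "axial_part (x v* rotation_e2 pi) (y v* rotation_e2 pi) = axial_part x y"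
    "plane_shear1 (x v* rotation_e2 pi) (y v* rotation_e2 pi) = plane_shear1 x y"
    "plane_shear2 (x v* rotation_e2 pi) (y v* rotation_e2 pi) = - plane_shear2 x y"
    "axial_shear1 (x v* rotation_e2 pi) (y v* rotation_e2 pi) = axial_shear1 x y"
    "axial_shear2 (x v* rotation_e2 pi) (y v* rotation_e2 pi) = - axial_shear2 x y" for x y
    by (simp_all add: bilinear_form_defs vector_matrix_mult_3 rotation_e2_pi_nth)
  then show ?thesis by (simp add: preserves_form_def trigonal_form_def)
qed

text \<open>Read the two plane shears as real and imaginary part of one complex number, and the two
  axial shears likewise. The substitution multiplies the first number by a primitive cube root of
  unity and the second by its conjugate. This fixes inner products within each pair, and also the
  real part of the product of the two numbers, which is the coupling term.\<close>

lemma preserves_form_rotation_e3: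
  "preserves_form (trigonal_form \<alpha> \<beta> \<gamma> \<delta> \<epsilon> \<zeta>) (rotation_e3 (2 * pi / 3))"
proof -
  define s :: real where "s = sqrt 3 / 2"
  have s: "s * s = 3 / 4" "s * (s * t) = 3 / 4 * t" for t
    by (simp_all add: s_def)
  define R where "R = rotation_e3 (2 * pi / 3)"
  have R: "R $ 1 $ 1 = -1/2" "R $ 1 $ 2 = - s" "R $ 1 $ 3 = 0" "R $ 2 $ 1 = s" "R $ 2 $ 2 = -1/2"
    "R $ 2 $ 3 = 0" "R $ 3 $ 1 = 0" "R $ 3 $ 2 = 0" "R $ 3 $ 3 = 1"
    by (simp_all add: R_def s_def rotation_e3_120_nth)
  have rot: "plane_trace (x v* R) (y v* R) = plane_trace x y"
    "axial_part (x v* R) (y v* R) = axial_part x y"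
    "plane_shear1 (x v* R) (y v* R) = - plane_shear1 x y / 2 - s * plane_shear2 x y"
    "plane_shear2 (x v* R) (y v* R) = s * plane_shear1 x y - plane_shear2 x y / 2"
    "axial_shear1 (x v* R) (y v* R) = - axial_shear1 x y / 2 + s * axial_shear2 x y"
    "axial_shear2 (x v* R) (y v* R) = - s * axial_shear1 x y - axial_shear2 x y / 2" for x y
    by (simp_all add: bilinear_form_defs vector_matrix_mult_3 R s field_simps)
  \<comment> \<open>\<open>a\<close> and \<open>b\<close> treat the plane and the axial pair;
    \<open>c\<close> and \<open>d\<close> are the two halves of the coupling term.\<close>
  have a: "(- p / 2 - s * q) * (- p' / 2 - s * q') + (s * p - q / 2) * (s * p' - q' / 2)
      = p * p' + q * q'" for p q p' q'
    by (simp add: s algebra_simps)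
  have b: "(- p / 2 + s * q) * (- p' / 2 + s * q') + (- s * p - q / 2) * (- s * p' - q' / 2)
      = p * p' + q * q'" for p q p' q'
    by (simp add: s algebra_simps)
  have c: "(- p / 2 - s * q) * (- p' / 2 + s * q') - (s * p - q / 2) * (- s * p' - q' / 2)
      = p * p' - q * q'" for p q p' q'
    by (simp add: s algebra_simps)
  have d: "(- p' / 2 + s * q') * (- p / 2 - s * q) - (- s * p' - q' / 2) * (s * p - q / 2)
      = p' * p - q' * q" for p q p' q'
    by (simp add: s algebra_simps)
  show ?thesis
    unfolding preserves_form_def trigonal_form_def R_def[symmetric] rot a b c d by simp
qed

lemma preserves_form_trigonal:
  assumes "Q \<in> D3_Z2c"
  shows "preserves_form (trigonal_form \<alpha> \<beta> \<gamma> \<delta> \<epsilon> \<zeta>) Q"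
proof -
  let ?F = "trigonal_form \<alpha> \<beta> \<gamma> \<delta> \<epsilon> \<zeta>"
  have "orthogonal_matrix Q \<and> preserves_form ?F Q" if "Q \<in> D3" for Q
    using that unfolding D3_def
    by (rule preserves_form_generate[rotated])
      (auto simp: orthogonal_rotation_e3_120 orthogonal_rotation_e2_pi
        preserves_form_rotation_e2 preserves_form_rotation_e3)
  moreover have "orthogonal_matrix (- mat 1 :: real^3^3)"
    by (simp add: orthogonal_matrix vec_eq_iff forall_3 matrix_matrix_mult_def transpose_def sum_3 mat_def)
  \<comment> \<open>Each bilinear form is unchanged when both of its arguments change sign.\<close>
  moreover have "preserves_form ?F (- mat 1)"
    by (simp add: preserves_form_def trigonal_form_def bilinear_form_defs vector_matrix_mult_3 mat_def)
  ultimately have "orthogonal_matrix Q \<and> preserves_form ?F Q" if "Q \<in> D3 \<union> {- mat 1}" for Q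
    using that by blast
  then show ?thesis
    using preserves_form_generate[of "D3 \<union> {- mat 1}" ?F Q] assms unfolding D3_Z2c_def by blast
qed

text \<open>Multilinear expansion over the basis. With rows of \<open>Q\<close> as arguments, the
  right side is the sum in \<open>invariant4\<close>.\<close>

lemma trigonal_form_eq_sum:
  "trigonal_form \<alpha> \<beta> \<gamma> \<delta> \<epsilon> \<zeta> x y z w = (\<Sum>i\<in>UNIV. \<Sum>j\<in>UNIV. \<Sum>l\<in>UNIV. \<Sum>m\<in>UNIV.
     x$i * y$j * z$l * w$m * trigonal_tensor \<alpha> \<beta> \<gamma> \<delta> \<epsilon> \<zeta> i j l m)"
  by (simp add: sum_3 trigonal_tensor_def trigonal_form_def bilinear_form_defs axis_def algebra_simps)

lemma invariant4_trigonal_tensor: "invariant4 D3_Z2c (trigonal_tensor \<alpha> \<beta> \<gamma> \<delta> \<epsilon> \<zeta>)"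
proof -
  have row: "axis i 1 v* Q = Q $ i" for i and Q :: "real^3^3"
    by (simp add: vector_matrix_mult_def axis_def vec_eq_iff if_distrib if_distribR cong: if_cong)
  have "trigonal_form \<alpha> \<beta> \<gamma> \<delta> \<epsilon> \<zeta> (Q$i) (Q$j) (Q$l) (Q$m) = trigonal_tensor \<alpha> \<beta> \<gamma> \<delta> \<epsilon> \<zeta> i j l m"
    if "Q \<in> D3_Z2c" for Q i j l m
    using preserves_form_trigonal[OF that] unfolding preserves_form_def trigonal_tensor_def
    by (metis row)
  then show ?thesis unfolding invariant4_def trigonal_form_eq_sum by blast
qed

text \<open>These are the test materials: with both higher-order tensors zero, equilibrium involves
  the elasticity tensor alone.\<close>

lemma trigonal_tensor_in_class:
  "(trigonal_tensor \<alpha> \<beta> \<gamma> \<delta> \<epsilon> \<zeta>, \<lambda>_ _ _ _ _. 0, \<lambda>_ _ _ _ _ _. 0) \<in> trigonal_class"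
  unfolding trigonal_class_def strain_gradient_materials_def
  using invariant4_trigonal_tensor
  by (auto simp: invariant6_def trigonal_tensor_def trigonal_form_def bilinear_form_defs algebra_simps)

section \<open>Classification of the invariant elasticity tensors\<close>

text \<open>Of the 21 components left by the index symmetries, the rotation about \<open>e2\<close>
  kills 8, and the rotation about \<open>e3\<close> gives 7 relations, which leaves 6. The arguments
  are read off from entries of \<open>trigonal_tensor\<close>; for instance, the entries
  \<open>1 1 1 1\<close> and \<open>1 1 2 2\<close> are \<open>\<alpha> + \<epsilon>\<close> and
  \<open>\<alpha> - \<epsilon>\<close>.\<close>

lemma invariant_tensor_eq_trigonal_tensor:
  assumes sym: "\<And>i j l m. C i j l m = C j i l m" "\<And>i j l m. C i j l m = C l m i j"
    and inv: "invariant4 D3_Z2c C"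
  shows "C = trigonal_tensor ((C 1 1 1 1 + C 1 1 2 2) / 2) (C 1 1 3 3) (C 3 3 3 3)
    (C 1 3 1 3) (C 1 2 1 2) (C 1 1 1 3)"
proof -
  have gen: "rotation_e3 (2 * pi / 3) \<in> D3_Z2c" "rotation_e2 pi \<in> D3_Z2c"
    unfolding D3_Z2c_def D3_def by (auto intro!: generate.incl)
  note invC = inv[unfolded invariant4_def, rule_format]
  have sym': "C i j l m = C i j m l" for i j l m
    using sym by metis
  \<comment> \<open>\<open>rotation_e2 pi\<close> is diagonal with entries \<open>-1\<close>,
    \<open>1\<close>, \<open>-1\<close>, so its action multiplies each component by a sign; an
    invariant component with sign \<open>-1\<close> equals its own negative.\<close>
  have mirror: "C i j l m = 0"
    if "rotation_e2 pi $ i $ i * rotation_e2 pi $ j $ j * rotation_e2 pi $ l $ l * rotation_e2 pi $ m $ m = -1"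
    for i j l m
  proof -
    have "(\<Sum>b\<in>UNIV. rotation_e2 pi $ a $ b * f b) = rotation_e2 pi $ a $ a * f a" for a f
      using exhaust_3[of a] by (auto simp: sum_3 rotation_e2_pi_nth)
    then have "rotation_e2 pi $ i $ i * (rotation_e2 pi $ j $ j * (rotation_e2 pi $ l $ l
        * (rotation_e2 pi $ m $ m * C i j l m))) = C i j l m"
      using invC[OF gen(2), of i j l m] by (simp add: mult.assoc flip: sum_distrib_left)
    then show ?thesis using that by (simp flip: mult.assoc)
  qed
  have zero: "C 1 1 1 2 = 0" "C 1 1 2 3 = 0" "C 2 2 1 2 = 0" "C 2 2 2 3 = 0" "C 3 3 1 2 = 0" "C 3 3 2 3 = 0"
    "C 1 2 1 3 = 0" "C 1 3 2 3 = 0"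
    by (rule mirror, simp add: rotation_e2_pi_nth)+
  define s :: real where "s = sqrt 3 / 2"
  have s: "s * s = 3 / 4" "s * (s * t) = 3 / 4 * t" "t * s * s = 3 / 4 * t" for t
    by (simp_all add: s_def)
  define R where "R = rotation_e3 (2 * pi / 3)"
  have R: "R $ 1 $ 1 = -1/2" "R $ 1 $ 2 = - s" "R $ 1 $ 3 = 0" "R $ 2 $ 1 = s" "R $ 2 $ 2 = -1/2"
    "R $ 2 $ 3 = 0" "R $ 3 $ 1 = 0" "R $ 3 $ 2 = 0" "R $ 3 $ 3 = 1"
    by (simp_all add: R_def s_def rotation_e3_120_nth)
  note rot = invC[OF gen(1), folded R_def, unfolded sum_3]
  \<comment> \<open>\<open>std\<close> sorts each index pair and \<open>flip\<close> orders the two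
    pairs. Together they rewrite every component to one of 21 representatives, so that instances of
    \<open>rot\<close> become relations among these.\<close>
  have std: "C 2 1 l m = C 1 2 l m" "C 3 1 l m = C 1 3 l m" "C 3 2 l m = C 2 3 l m"
    "C l m 2 1 = C l m 1 2" "C l m 3 1 = C l m 1 3" "C l m 3 2 = C l m 2 3" for l m
    using sym sym' by metis+
  have flip: "C 2 2 1 1 = C 1 1 2 2" "C 3 3 1 1 = C 1 1 3 3" "C 3 3 2 2 = C 2 2 3 3"
    "C 1 2 1 1 = C 1 1 1 2" "C 1 3 1 1 = C 1 1 1 3" "C 2 3 1 1 = C 1 1 2 3"
    "C 1 2 2 2 = C 2 2 1 2" "C 1 3 2 2 = C 2 2 1 3" "C 2 3 2 2 = C 2 2 2 3"
    "C 1 2 3 3 = C 3 3 1 2" "C 1 3 3 3 = C 3 3 1 3" "C 2 3 3 3 = C 3 3 2 3"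
    "C 1 3 1 2 = C 1 2 1 3" "C 2 3 1 2 = C 1 2 2 3" "C 2 3 1 3 = C 1 3 2 3"
    by (rule sym(2))+
  note norm = R std flip zero s
  have r3313: "C 3 3 1 3 = 0" using rot[of 3 3 1 3] by (simp add: norm)
  have r1133: "C 2 2 3 3 = C 1 1 3 3" using rot[of 1 1 3 3] by (simp add: norm)
  have r1313: "C 2 3 2 3 = C 1 3 1 3" using rot[of 1 3 1 3] by (simp add: norm)
  have r1111: "C 2 2 2 2 = C 1 1 1 1" "C 1 1 1 1 = C 1 1 2 2 + 2 * C 1 2 1 2"
    using rot[of 1 1 1 1] rot[of 2 2 2 2] by (simp_all add: norm)
  have r1113: "C 2 2 1 3 = - C 1 1 1 3" "C 1 2 2 3 = - C 1 1 1 3"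
    using rot[of 1 1 1 3] rot[of 2 2 1 3] rot[of 1 2 2 3] by (simp_all add: norm)
  show ?thesis
    unfolding fun_eq_iff forall_3 trigonal_tensor_def trigonal_form_def bilinear_form_defs
    by (simp add: axis_def std flip zero r3313 r1133 r1313 r1111 r1113 field_simps)
qed

section \<open>Equilibrium as a condition on second derivatives\<close>

definition hessian :: "(real^3 \<Rightarrow> real^3) \<Rightarrow> 3 \<Rightarrow> 3 \<Rightarrow> 3 \<Rightarrow> real^3 \<Rightarrow> real" where
  "hessian u l j k = partial_deriv j (partial_deriv k (\<lambda>y. u y $ l))"

lemma hessian_commute:
  "\<lbrakk>open S; smooth_on S u; x \<in> S\<rbrakk> \<Longrightarrow> hessian u l j k x = hessian u l k j x"
  unfolding hessian_def by (rule partial_deriv_commute[OF _ smooth_on_component])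

lemma smooth_on_hessian: "\<lbrakk>open S; smooth_on S u\<rbrakk> \<Longrightarrow> smooth_on S (hessian u l j k)"
  unfolding hessian_def by (intro smooth_on_partial_deriv smooth_on_component)

lemma strain_derivative:
  assumes "open S" "smooth_on S u" "x \<in> S"
  shows "strain u l m differentiable (at x)"
    and "partial_deriv j (strain u l m) x = (hessian u l j m x + hessian u m j l x) / 2"
proof -
  note d = smooth_on_differentiable[OF smooth_on_partial_deriv[OF assms(1)
    smooth_on_component[OF assms(1,2)]] assms(3)]
  have s: "strain u l m =
      (\<lambda>x. (1/2) * (partial_deriv m (\<lambda>y. u y $ l) x + partial_deriv l (\<lambda>y. u y $ m) x))"
    by (simp add: strain_def fun_eq_iff)
  show "strain u l m differentiable (at x)"
    unfolding s by (intro differentiable_mult differentiable_const differentiable_add d)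
  show "partial_deriv j (strain u l m) x = (hessian u l j m x + hessian u m j l x) / 2"
    unfolding s by (subst partial_deriv_cmult) (simp_all add: partial_deriv_add d differentiable_add hessian_def)
qed

text \<open>With \<open>M = 0\<close> the stress is linear in the strain alone, so its derivatives
  involve second derivatives of \<open>u\<close> only.\<close>

lemma partial_deriv_stress:
  assumes "open S" "smooth_on S u" "x \<in> S"
  shows "partial_deriv j (stress (C, \<lambda>_ _ _ _ _. 0, A) u i j) x
    = (\<Sum>l\<in>UNIV. \<Sum>m\<in>UNIV. C i j l m * ((hessian u l j m x + hessian u m j l x) / 2))"
proof -
  note d = strain_derivative[OF assms]
  have "stress (C, \<lambda>_ _ _ _ _. 0, A) u i j =
      (\<lambda>x. \<Sum>l\<in>UNIV. \<Sum>m\<in>UNIV. C i j l m * strain u l m x)"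
    by (simp add: fun_eq_iff)
  then show ?thesis
    by (simp add: partial_deriv_sum partial_deriv_cmult d differentiable_sum differentiable_mult)
qed

text \<open>The entry \<open>l j k\<close> is the second derivative \<open>u\<^sub>l\<^sub>,\<^sub>j\<^sub>k\<close>.\<close>

definition trigonal_hessian :: "real \<Rightarrow> real \<Rightarrow> real \<Rightarrow> real \<Rightarrow> 3 \<Rightarrow> 3 \<Rightarrow> 3 \<Rightarrow> real" where
  "trigonal_hessian p q r s l j k =
    (if l = 1 then
       (if {j, k} = {1, 2} then p else if {j, k} = {1, 3} then q else if {j, k} = {2, 3} then r else 0)
     else if l = 2 then
       (if {j, k} = {1} then p else if {j, k} = {2} then - p
        else if {j, k} = {1, 3} then s else if {j, k} = {2, 3} then - q else 0)
     else
       (if {j, k} = {1} then - 2 * q else if {j, k} = {2} then 2 * q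
        else if {j, k} = {1, 2} then - r - s else 0))"

text \<open>Linear algebra in the 18 independent numbers \<open>h l j k\<close> at one point. The
  sum is linear in six free moduli, so it vanishes identically iff all coefficients do. These are 5,
  5 and 4 equations for \<open>i = 1\<close>, \<open>2\<close>, \<open>3\<close>; they leave the
  four listed entries free.\<close>

lemma trigonal_divergence_eq_0_iff:
  assumes sym: "\<And>l j k. h l j k = h l k j"
  shows "(\<forall>\<alpha> \<beta> \<gamma> \<delta> \<epsilon> \<zeta> i. (\<Sum>j\<in>UNIV. \<Sum>l\<in>UNIV. \<Sum>m\<in>UNIV.
      trigonal_tensor \<alpha> \<beta> \<gamma> \<delta> \<epsilon> \<zeta> i j l m * ((h l j m + h m j l) / 2)) = 0)
    \<longleftrightarrow> h = trigonal_hessian (h 1 1 2) (h 1 1 3) (h 1 2 3) (h 2 1 3)" (is "?L \<longleftrightarrow> ?R")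
proof -
  define D where "D \<alpha> \<beta> \<gamma> \<delta> \<epsilon> \<zeta> i = (\<Sum>j\<in>UNIV. \<Sum>l\<in>UNIV. \<Sum>m\<in>UNIV.
      trigonal_tensor \<alpha> \<beta> \<gamma> \<delta> \<epsilon> \<zeta> i j l m * ((h l j m + h m j l) / 2))" for \<alpha> \<beta> \<gamma> \<delta> \<epsilon> \<zeta> i
  have std: "h l 2 1 = h l 1 2" "h l 3 1 = h l 1 3" "h l 3 2 = h l 2 3" for l
    by (rule sym)+
  have D1: "D \<alpha> \<beta> \<gamma> \<delta> \<epsilon> \<zeta> 1 = \<alpha> * (h 1 1 1 + h 2 1 2) + \<beta> * h 3 1 3 + \<delta> * (h 1 3 3 + h 3 1 3)
      + \<epsilon> * (h 1 1 1 + h 1 2 2) + \<zeta> * (2 * h 1 1 3 - 2 * h 2 2 3 + h 3 1 1 - h 3 2 2)"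
    for \<alpha> \<beta> \<gamma> \<delta> \<epsilon> \<zeta>
    by (simp add: D_def sum_3 trigonal_tensor_def trigonal_form_def bilinear_form_defs axis_def std field_simps)
  have D2: "D \<alpha> \<beta> \<gamma> \<delta> \<epsilon> \<zeta> 2 = \<alpha> * (h 1 1 2 + h 2 2 2) + \<beta> * h 3 2 3 + \<delta> * (h 2 3 3 + h 3 2 3)
      + \<epsilon> * (h 2 1 1 + h 2 2 2) - 2 * \<zeta> * (h 1 2 3 + h 2 1 3 + h 3 1 2)"
    for \<alpha> \<beta> \<gamma> \<delta> \<epsilon> \<zeta>
    by (simp add: D_def sum_3 trigonal_tensor_def trigonal_form_def bilinear_form_defs axis_def std field_simps)
  have D3: "D \<alpha> \<beta> \<gamma> \<delta> \<epsilon> \<zeta> 3 = \<beta> * (h 1 1 3 + h 2 2 3) + \<gamma> * h 3 3 3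
      + \<delta> * (h 1 1 3 + h 2 2 3 + h 3 1 1 + h 3 2 2) + \<zeta> * (h 1 1 1 - h 1 2 2 - 2 * h 2 1 2)"
    for \<alpha> \<beta> \<gamma> \<delta> \<epsilon> \<zeta>
    by (simp add: D_def sum_3 trigonal_tensor_def trigonal_form_def bilinear_form_defs axis_def std field_simps)
  have R: "?R \<longleftrightarrow> h 1 1 1 = 0 \<and> h 1 2 2 = 0 \<and> h 1 3 3 = 0
      \<and> h 2 1 1 = h 1 1 2 \<and> h 2 2 2 = - h 1 1 2 \<and> h 2 3 3 = 0 \<and> h 2 1 2 = 0 \<and> h 2 2 3 = - h 1 1 3
      \<and> h 3 1 1 = - 2 * h 1 1 3 \<and> h 3 2 2 = 2 * h 1 1 3 \<and> h 3 3 3 = 0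
      \<and> h 3 1 2 = - h 1 2 3 - h 2 1 3 \<and> h 3 1 3 = 0 \<and> h 3 2 3 = 0"
    unfolding fun_eq_iff forall_3 trigonal_hessian_def std by (auto simp: doubleton_eq_iff)
  show ?thesis
    unfolding D_def[symmetric] R
  proof
    assume "\<forall>\<alpha> \<beta> \<gamma> \<delta> \<epsilon> \<zeta> i. D \<alpha> \<beta> \<gamma> \<delta> \<epsilon> \<zeta> i = 0"
    then have D0: "D \<alpha> \<beta> \<gamma> \<delta> \<epsilon> \<zeta> i = 0" for \<alpha> \<beta> \<gamma> \<delta> \<epsilon> \<zeta> i by blast
    \<comment> \<open>One modulus equal to 1 and the others 0 isolates one coefficient.\<close>
    note basis = D0[of 1 0 0 0 0 0] D0[of 0 1 0 0 0 0] D0[of 0 0 1 0 0 0] D0[of 0 0 0 1 0 0]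
      D0[of 0 0 0 0 1 0] D0[of 0 0 0 0 0 1]
    show "h 1 1 1 = 0 \<and> h 1 2 2 = 0 \<and> h 1 3 3 = 0
      \<and> h 2 1 1 = h 1 1 2 \<and> h 2 2 2 = - h 1 1 2 \<and> h 2 3 3 = 0 \<and> h 2 1 2 = 0 \<and> h 2 2 3 = - h 1 1 3
      \<and> h 3 1 1 = - 2 * h 1 1 3 \<and> h 3 2 2 = 2 * h 1 1 3 \<and> h 3 3 3 = 0
      \<and> h 3 1 2 = - h 1 2 3 - h 2 1 3 \<and> h 3 1 3 = 0 \<and> h 3 2 3 = 0"
      using basis[of 1, unfolded D1] basis[of 2, unfolded D2] basis[of 3, unfolded D3] by simp
  next
    assume "h 1 1 1 = 0 \<and> h 1 2 2 = 0 \<and> h 1 3 3 = 0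
      \<and> h 2 1 1 = h 1 1 2 \<and> h 2 2 2 = - h 1 1 2 \<and> h 2 3 3 = 0 \<and> h 2 1 2 = 0 \<and> h 2 2 3 = - h 1 1 3
      \<and> h 3 1 1 = - 2 * h 1 1 3 \<and> h 3 2 2 = 2 * h 1 1 3 \<and> h 3 3 3 = 0
      \<and> h 3 1 2 = - h 1 2 3 - h 2 1 3 \<and> h 3 1 3 = 0 \<and> h 3 2 3 = 0"
    then show "\<forall>\<alpha> \<beta> \<gamma> \<delta> \<epsilon> \<zeta> i. D \<alpha> \<beta> \<gamma> \<delta> \<epsilon> \<zeta> i = 0"
      by (simp add: forall_3 D1 D2 D3)
  qed
qed

section \<open>The inhomogeneous polynomial field\<close>

text \<open>The parameters stand for \<open>a123\<close>, \<open>a12\<close>, \<open>a13\<close>,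
  \<open>a23\<close>, \<open>b13\<close> in this order. There is one scalar function per component,
  so that \<open>second_partials_eq_iff\<close> applies to each.\<close>

definition inhomogeneous_part :: "real \<Rightarrow> real \<Rightarrow> real \<Rightarrow> real \<Rightarrow> real \<Rightarrow> 3 \<Rightarrow> real^3 \<Rightarrow> real" where
  "inhomogeneous_part a b c d e l = (\<lambda>x.
    if l = 1 then a * x$1 * x$2 * x$3 + b * x$1 * x$2 + c * x$1 * x$3 + d * x$2 * x$3
    else if l = 2 then 1/2 * (b + a * x$3) * ((x$1)\<^sup>2 - (x$2)\<^sup>2) + e * x$1 * x$3 - c * x$2 * x$3
    else - a * (x$1)\<^sup>2 * x$2 - (d + e) * x$1 * x$2 + 1/3 * a * (x$2)^3 - c * ((x$1)\<^sup>2 - (x$2)\<^sup>2))"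

lemmas differentiable_polynomial = differentiable_nth differentiable_const differentiable_add
  differentiable_mult differentiable_diff differentiable_minus differentiable_power
  differentiable_divide_const

lemmas partial_deriv_polynomial = partial_deriv_nth partial_deriv_const partial_deriv_add
  partial_deriv_mult partial_deriv_diff partial_deriv_minus partial_deriv_divide_const

text \<open>Equations between functions can be rewritten beneath a second
  \<open>partial_deriv\<close>. Squares are written as products to suit the product rule in
  \<open>partial_deriv_polynomial\<close>.\<close>

lemma partial_deriv_inhomogeneous_part:
  "partial_deriv k (inhomogeneous_part a b c d e l) =
    (if l = 1 then
       if k = 1 then (\<lambda>x. a * x$2 * x$3 + b * x$2 + c * x$3)
       else if k = 2 then (\<lambda>x. a * x$1 * x$3 + b * x$1 + d * x$3)
       else (\<lambda>x. a * x$1 * x$2 + c * x$1 + d * x$2)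
     else if l = 2 then
       if k = 1 then (\<lambda>x. (b + a * x$3) * x$1 + e * x$3)
       else if k = 2 then (\<lambda>x. - (b + a * x$3) * x$2 - c * x$3)
       else (\<lambda>x. 1/2 * a * (x$1 * x$1 - x$2 * x$2) + e * x$1 - c * x$2)
     else
       if k = 1 then (\<lambda>x. - 2 * a * x$1 * x$2 - (d + e) * x$2 - 2 * c * x$1)
       else if k = 2 then (\<lambda>x. a * (x$2 * x$2 - x$1 * x$1) - (d + e) * x$1 + 2 * c * x$2)
       else (\<lambda>x. 0))"
  using exhaust_3[of l] exhaust_3[of k]
  by (elim disjE) (simp_all add: fun_eq_iff inhomogeneous_part_def power2_eq_square power3_eq_cube
      differentiable_polynomial partial_deriv_polynomial field_simps)

lemma differentiable_inhomogeneous_part: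
  "inhomogeneous_part a b c d e l differentiable (at x)"
  "partial_deriv k (inhomogeneous_part a b c d e l) differentiable (at x)"
  unfolding partial_deriv_inhomogeneous_part
  using exhaust_3[of l] by (auto simp: inhomogeneous_part_def differentiable_polynomial)

text \<open>This explains the asserted polynomials: they are double antiderivatives of
  \<open>trigonal_hessian\<close> with affine parameters that share the slope
  \<open>a\<close>.\<close>

lemma second_partials_inhomogeneous_part:
  "partial_deriv j (partial_deriv k (inhomogeneous_part a b c d e l)) x =
     trigonal_hessian (a * x$3 + b) (a * x$2 + c) (a * x$1 + d) (a * x$1 + e) l j k"
proof -
  have "\<forall>l k j. partial_deriv j (partial_deriv k (inhomogeneous_part a b c d e l)) x =
     trigonal_hessian (a * x$3 + b) (a * x$2 + c) (a * x$1 + d) (a * x$1 + e) l j k"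
    unfolding forall_3 partial_deriv_inhomogeneous_part
    by (intro conjI; simp add: trigonal_hessian_def doubleton_eq_iff
      differentiable_polynomial partial_deriv_polynomial; simp add: algebra_simps)
  then show ?thesis by blast
qed

section \<open>Compatibility of the second derivatives\<close>

text \<open>Each first derivative of the four free entries is a third derivative of
  \<open>u\<close>. Reordering its directions turns it into a derivative of a vanishing entry or
  into \<open>partial_deriv 3 p\<close>. So each entry varies along one axis, all with a common
  slope, and the same argument shows that this slope has zero gradient.\<close>

lemma trigonal_hessian_integrable:
  assumes S: "open S" "convex S" and u: "smooth_on S u"
    and H: "\<And>x l j k. x \<in> S \<Longrightarrow> hessian u l j k x =
      trigonal_hessian (hessian u 1 1 2 x) (hessian u 1 1 3 x) (hessian u 1 2 3 x) (hessian u 2 1 3 x) l j k"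
  shows "\<exists>a b c d e. \<forall>x\<in>S. \<forall>l j k. hessian u l j k x =
     trigonal_hessian (a * x$3 + b) (a * x$2 + c) (a * x$1 + d) (a * x$1 + e) l j k"
proof -
  \<comment> \<open>Third derivatives are symmetric in all directions: \<open>swap\<close> exchanges
    the outer two and \<open>swap'\<close> the inner two.\<close>
  have swap: "partial_deriv i (hessian u l j k) x = partial_deriv j (hessian u l i k) x"
    and swap': "partial_deriv i (hessian u l j k) x = partial_deriv i (hessian u l k j) x"
    if "x \<in> S" for i j k l x
  proof -
    show "partial_deriv i (hessian u l j k) x = partial_deriv j (hessian u l i k) x"
      unfolding hessian_def
      by (rule partial_deriv_commute[OF S(1) smooth_on_partial_deriv[OF S(1) smooth_on_component[OF S(1) u]] that])
    show "partial_deriv i (hessian u l j k) x = partial_deriv i (hessian u l k j) x"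
      by (rule partial_deriv_cong[OF S(1) that hessian_commute[OF S(1) u]])
  qed
  have zero: "partial_deriv i f x = 0" if "x \<in> S" "\<And>y. y \<in> S \<Longrightarrow> f y = 0" for i f x
    using partial_deriv_cong[OF S(1) that(1), of f "\<lambda>_. 0" i] that(2) by (simp add: partial_deriv_const)
  have H0: "hessian u 1 1 1 x = 0" "hessian u 1 2 2 x = 0" "hessian u 1 3 3 x = 0"
      "hessian u 2 1 2 x = 0" "hessian u 2 3 3 x = 0" "hessian u 2 1 1 x = hessian u 1 1 2 x"
    if "x \<in> S" for x
    using H[OF that, of 1 1 1] H[OF that, of 1 2 2] H[OF that, of 1 3 3] H[OF that, of 2 1 2]
      H[OF that, of 2 3 3] H[OF that, of 2 1 1]
    by (simp_all add: trigonal_hessian_def doubleton_eq_iff)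
  define p q r s where pqrs: "p = hessian u 1 1 2" "q = hessian u 1 1 3" "r = hessian u 1 2 3"
    "s = hessian u 2 1 3"
  note smooth = smooth_on_hessian[OF S(1) u]
  have smooth_pq: "smooth_on S p" "smooth_on S q" unfolding pqrs by (rule smooth)+
  have p: "partial_deriv 1 p x = 0" "partial_deriv 2 p x = 0" if "x \<in> S" for x
    using swap'[OF that, of 1 1 1 2] swap[OF that, of 1 1 2 1] swap[OF that, of 2 1 1 2]
      zero[OF that H0(1)] zero[OF that H0(2)]
    by (simp_all add: pqrs)
  \<comment> \<open>The middle equation compares two orders of
    \<open>u\<^sub>1\<^sub>,\<^sub>1\<^sub>2\<^sub>3\<close>; the outer ones differentiate
    \<open>u\<^sub>1\<^sub>,\<^sub>1\<^sub>1 = 0\<close> and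
    \<open>u\<^sub>1\<^sub>,\<^sub>3\<^sub>3 = 0\<close>.\<close>
  have q: "partial_deriv 1 q x = 0" "partial_deriv 2 q x = partial_deriv 3 p x" "partial_deriv 3 q x = 0"
    if "x \<in> S" for x
    using swap'[OF that, of 1 1 1 3] swap[OF that, of 1 1 3 1] swap'[OF that, of 2 1 1 3]
      swap[OF that, of 2 1 3 1] swap'[OF that, of 3 1 2 1] swap[OF that, of 3 1 1 3]
      zero[OF that H0(1)] zero[OF that H0(3)]
    by (simp_all add: pqrs)
  have r: "partial_deriv 1 r x = partial_deriv 3 p x" "partial_deriv 2 r x = 0" "partial_deriv 3 r x = 0"
    if "x \<in> S" for x
    using swap[OF that, of 1 1 2 3] q(2)[OF that] swap'[OF that, of 2 1 2 3] swap[OF that, of 2 1 3 2]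
      swap[OF that, of 3 1 2 3] zero[OF that H0(2)] zero[OF that H0(3)]
    by (simp_all add: pqrs)
  \<comment> \<open>The second component is tied to the first by
    \<open>u\<^sub>2\<^sub>,\<^sub>1\<^sub>1 = u\<^sub>1\<^sub>,\<^sub>1\<^sub>2\<close>:
    differentiated along 3, it gives the derivative of \<open>s\<close> along 1.\<close>
  have s: "partial_deriv 1 s x = partial_deriv 3 p x" "partial_deriv 2 s x = 0" "partial_deriv 3 s x = 0"
    if "x \<in> S" for x
    using swap'[OF that, of 1 2 1 3] swap[OF that, of 1 2 3 1]
      partial_deriv_cong[OF S(1) that, of "hessian u 2 1 1" "hessian u 1 1 2" 3, OF H0(6)]
      swap'[OF that, of 2 2 1 3] swap[OF that, of 2 2 3 1] swap'[OF that, of 3 2 2 1]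
      swap[OF that, of 3 2 1 3] zero[OF that H0(4)] zero[OF that H0(5)]
    by (simp_all add: pqrs)
  \<comment> \<open>For \<open>k = 1\<close> and \<open>k = 2\<close> the two derivatives of
    \<open>p\<close> are exchanged. For \<open>k = 3\<close>, \<open>partial_deriv 3 p\<close> is
    first replaced by \<open>partial_deriv 2 q\<close>, and \<open>q\<close> does not vary along
    3.\<close>
  have "partial_deriv k (partial_deriv 3 p) x = partial_deriv k (\<lambda>_. 0) x" if "x \<in> S" for k x
  proof -
    have "partial_deriv 1 (partial_deriv 3 p) x = 0" "partial_deriv 2 (partial_deriv 3 p) x = 0"
      using partial_deriv_commute[OF S(1) smooth_pq(1) that, of _ 3]
        zero[OF that p(1)] zero[OF that p(2)] by simp_all
    moreover have "partial_deriv 3 (partial_deriv 3 p) x = 0"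
      using partial_deriv_cong[OF S(1) that, of "partial_deriv 2 q" "partial_deriv 3 p" 3, OF q(2)]
        zero[OF that q(3)] partial_deriv_commute[OF S(1) smooth_pq(2) that, of 3 2] by simp
    ultimately show ?thesis using exhaust_3[of k] by (auto simp: partial_deriv_const)
  qed
  then obtain a where a: "\<And>x. x \<in> S \<Longrightarrow> partial_deriv 3 p x = a"
    using equal_partial_derivs_imp_differ_by_constant[OF S, of "partial_deriv 3 p" "\<lambda>_. 0"]
      smooth_on_differentiable[OF smooth_on_partial_deriv[OF S(1) smooth]]
    unfolding pqrs by auto
  have affine: "\<exists>c. \<forall>x\<in>S. f x = a * x$i + c"
    if "smooth_on S f" "\<And>x k. x \<in> S \<Longrightarrow> partial_deriv k f x = (if k = i then a else 0)" for f i
    using that smooth_on_differentiable[OF that(1)]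
    by (intro equal_partial_derivs_imp_differ_by_constant S)
       (auto simp: differentiable_polynomial partial_deriv_polynomial)
  have "partial_deriv k p x = (if k = 3 then a else 0)" "partial_deriv k q x = (if k = 2 then a else 0)"
    "partial_deriv k r x = (if k = 1 then a else 0)" "partial_deriv k s x = (if k = 1 then a else 0)"
    if "x \<in> S" for k x
    using exhaust_3[of k] p[OF that] q[OF that] r[OF that] s[OF that] a[OF that] by auto
  then obtain b c d e where bcde: "\<forall>x\<in>S. p x = a * x$3 + b" "\<forall>x\<in>S. q x = a * x$2 + c"
    "\<forall>x\<in>S. r x = a * x$1 + d" "\<forall>x\<in>S. s x = a * x$1 + e"
    using affine[of p 3] affine[of q 2] affine[of r 1] affine[of s 1] smooth unfolding pqrs by blast
  have "hessian u l j k x =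
     trigonal_hessian (a * x$3 + b) (a * x$2 + c) (a * x$1 + d) (a * x$1 + e) l j k"
    if "x \<in> S" for x l j k
    using H[OF that, of l j k, folded pqrs] bcde that by simp
  then show ?thesis by blast
qed

section \<open>Universality in terms of second derivatives\<close>

text \<open>The test materials have zero hyper-stress, so equilibrium at \<open>x\<close> makes the
  stress divergence vanish for every choice of the six moduli.\<close>

lemma universal_imp_trigonal_hessian:
  assumes "open \<Omega>" "smooth_on \<Omega> u" "universal_for \<Omega> trigonal_class u" "x \<in> \<Omega>"
  shows "(\<lambda>l j k. hessian u l j k x) =
    trigonal_hessian (hessian u 1 1 2 x) (hessian u 1 1 3 x) (hessian u 1 2 3 x) (hessian u 2 1 3 x)"
proof -
  have "(\<Sum>j\<in>UNIV. \<Sum>l\<in>UNIV. \<Sum>m\<in>UNIV.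
      trigonal_tensor \<alpha> \<beta> \<gamma> \<delta> \<epsilon> \<zeta> i j l m * ((hessian u l j m x + hessian u m j l x) / 2)) = 0"
    for \<alpha> \<beta> \<gamma> \<delta> \<epsilon> \<zeta> i
  proof -
    let ?\<mu> = "(trigonal_tensor \<alpha> \<beta> \<gamma> \<delta> \<epsilon> \<zeta>, \<lambda>_ _ _ _ _. 0, \<lambda>_ _ _ _ _ _. 0) :: material"
    have "hyper_stress ?\<mu> u i j k = (\<lambda>_. 0)" for j k
      by (simp add: fun_eq_iff)
    moreover have "partial_deriv j (\<lambda>_. 0) = (\<lambda>_. 0)" for j
      by (simp add: fun_eq_iff partial_deriv_const)
    ultimately have "(\<Sum>j\<in>UNIV. partial_deriv j (stress ?\<mu> u i j) x) = 0"
      using assms(3,4) trigonal_tensor_in_class[of \<alpha> \<beta> \<gamma> \<delta> \<epsilon> \<zeta>]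
      unfolding universal_for_def in_equilibrium_def by force
    then show ?thesis by (simp only: partial_deriv_stress[OF assms(1,2,4)])
  qed
  then show ?thesis
    by (subst trigonal_divergence_eq_0_iff[symmetric])
       (auto intro: hessian_commute[OF assms(1,2,4)])
qed

text \<open>The stress part vanishes by the classification of \<open>C\<close> and the algebraic
  equivalence for the divergence. Affine second derivatives of \<open>u\<close> make the
  hyper-stress affine, and equilibrium differentiates it twice.\<close>

lemma trigonal_hessian_imp_universal:
  assumes "open \<Omega>" "smooth_on \<Omega> u"
    and H: "\<And>x l j k. x \<in> \<Omega> \<Longrightarrow> hessian u l j k x =
      trigonal_hessian (a * x$3 + b) (a * x$2 + c) (a * x$1 + d) (a * x$1 + e) l j k"
  shows "universal_for \<Omega> trigonal_class u"
  unfolding universal_for_def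
proof
  fix \<mu> assume "\<mu> \<in> trigonal_class"
  then obtain C A where \<mu>: "\<mu> = (C, \<lambda>_ _ _ _ _. 0, A)" and inv: "invariant4 D3_Z2c C"
    and sym: "\<And>i j l m. C i j l m = C j i l m" "\<And>i j l m. C i j l m = C l m i j"
    unfolding trigonal_class_def strain_gradient_materials_def by blast
  obtain \<alpha> \<beta> \<gamma> \<delta> \<epsilon> \<zeta> where C: "C = trigonal_tensor \<alpha> \<beta> \<gamma> \<delta> \<epsilon> \<zeta>"
    using invariant_tensor_eq_trigonal_tensor[OF sym inv] by blast
  have affine_hessian: "affine_function_on \<Omega> (hessian u l j k)" for l j k
  proof (rule affine_function_on_cong[OF _ H[symmetric]])
    have uminus: "affine_function_on \<Omega> (\<lambda>x. - f x)" if "affine_function_on \<Omega> f" for f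
      using affine_function_on_cmult[OF that, of "-1"] by simp
    have diff: "affine_function_on \<Omega> (\<lambda>x. - f x - g x)"
      if "affine_function_on \<Omega> f" "affine_function_on \<Omega> g" for f g
      using affine_function_on_add[OF uminus[OF that(1)] uminus[OF that(2)]] by simp
    \<comment> \<open>The conditions in \<open>trigonal_hessian\<close> test indices and not the
      point, so \<open>P\<close> is constant in \<open>x\<close>.\<close>
    have affine_if: "affine_function_on \<Omega> (\<lambda>x. if P then f x else g x)"
      if "affine_function_on \<Omega> f" "affine_function_on \<Omega> g" for P f g
      using that by (cases P) simp_all
    show "affine_function_on \<Omega> (\<lambda>x.
      trigonal_hessian (a * x$3 + b) (a * x$2 + c) (a * x$1 + d) (a * x$1 + e) l j k)"
      unfolding trigonal_hessian_def
      by (intro affine_if affine_function_on_nth affine_function_on_const uminus diff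
          affine_function_on_cmult)
  qed
  show "in_equilibrium \<Omega> \<mu> u"
    unfolding in_equilibrium_def
  proof (intro ballI allI)
    fix x i assume x: "x \<in> \<Omega>"
    define h where "h l j k = hessian u l j k x" for l j k
    \<comment> \<open>The four parameters are recovered as entries of \<open>h\<close> itself, the
      form in which \<open>trigonal_divergence_eq_0_iff\<close> expects them.\<close>
    have "h = trigonal_hessian (h 1 1 2) (h 1 1 3) (h 1 2 3) (h 2 1 3)"
      unfolding h_def H[OF x] by (simp add: trigonal_hessian_def doubleton_eq_iff fun_eq_iff)
    moreover have "h l j k = h l k j" for l j k
      unfolding h_def by (rule hessian_commute[OF assms(1,2) x])
    ultimately have "(\<Sum>j\<in>UNIV. partial_deriv j (stress \<mu> u i j) x) = 0"
      unfolding \<mu> partial_deriv_stress[OF assms(1,2) x] C h_def[symmetric]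
      using trigonal_divergence_eq_0_iff[of h] by blast
    moreover have "partial_deriv k (partial_deriv j (hyper_stress \<mu> u i j k)) x = 0" for j k
    proof (rule second_partials_affine[OF assms(1) _ x])
      have "affine_function_on \<Omega> (partial_deriv n (strain u l m))" for l m n
      proof (rule affine_function_on_cong)
        show "affine_function_on \<Omega> (\<lambda>x. 1/2 * (hessian u l n m x + hessian u m n l x))"
          by (intro affine_function_on_cmult affine_function_on_add affine_hessian)
      qed (simp add: strain_derivative[OF assms(1,2)])
      then have "affine_function_on \<Omega> (\<lambda>x. \<Sum>l\<in>UNIV. \<Sum>m\<in>UNIV. \<Sum>n\<in>UNIV.
          A i j k l m n * partial_deriv n (strain u l m) x)"
        by (intro affine_function_on_sum affine_function_on_cmult finite)
      then show "affine_function_on \<Omega> (hyper_stress \<mu> u i j k)"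
        by (rule affine_function_on_cong) (simp add: \<mu>)
    qed
    ultimately show "(\<Sum>j\<in>UNIV. partial_deriv j (stress \<mu> u i j) x) -
      (\<Sum>j\<in>UNIV. \<Sum>k\<in>UNIV. partial_deriv k (partial_deriv j (hyper_stress \<mu> u i j k)) x) = 0"
      by simp
  qed
qed

text \<open>Each component is integrated separately by \<open>second_partials_eq_iff\<close>; the
  coefficient vectors of the linear parts become the rows of \<open>H\<close>, the constants the
  entries of \<open>w\<close>.\<close>

lemma hessian_eq_iff:
  assumes "open S" "convex S" "smooth_on S u"
  shows "(\<forall>x\<in>S. \<forall>l j k. hessian u l j k x =
      trigonal_hessian (a * x$3 + b) (a * x$2 + c) (a * x$1 + d) (a * x$1 + e) l j k)
    \<longleftrightarrow> (\<exists>(H :: real^3^3) w. \<forall>x\<in>S. \<forall>l. u x $ l = (H *v x + w) $ l + inhomogeneous_part a b c d e l x)"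
    (is "?L \<longleftrightarrow> ?R")
proof -
  have "?L \<longleftrightarrow> (\<forall>l. \<exists>v w. \<forall>x\<in>S. u x $ l = inhomogeneous_part a b c d e l x + v \<bullet> x + w)"
    unfolding hessian_def second_partials_inhomogeneous_part[symmetric]
      second_partials_eq_iff[OF assms(1,2) smooth_on_component[OF assms(1,3)]
        differentiable_inhomogeneous_part, symmetric] by blast
  also have "\<dots> \<longleftrightarrow> (\<exists>v w. \<forall>l. \<forall>x\<in>S. u x $ l = inhomogeneous_part a b c d e l x + v l \<bullet> x + w l)"
    by metis
  also have "\<dots> \<longleftrightarrow> ?R"
  proof
    assume "\<exists>v w. \<forall>l. \<forall>x\<in>S. u x $ l = inhomogeneous_part a b c d e l x + v l \<bullet> x + w l"
    then obtain v w where "\<forall>l. \<forall>x\<in>S. u x $ l = inhomogeneous_part a b c d e l x + v l \<bullet> x + w l"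
      by blast
    then show ?R
      by (intro exI[of _ "\<chi> l. v l"] exI[of _ "\<chi> l. w l"]) (simp add: matrix_vector_mul_component)
  next
    assume ?R
    then obtain H :: "real^3^3" and w where
      "\<forall>x\<in>S. \<forall>l. u x $ l = (H *v x + w) $ l + inhomogeneous_part a b c d e l x" by blast
    then show "\<exists>v w. \<forall>l. \<forall>x\<in>S. u x $ l = inhomogeneous_part a b c d e l x + v l \<bullet> x + w l"
      by (intro exI[of _ "\<lambda>l. H $ l"] exI[of _ "\<lambda>l. w $ l"]) (simp add: matrix_vector_mul_component)
  qed
  finally show ?thesis .
qed

theorem proposition3p15:
  fixes \<Omega> :: "(real^3) set" and u :: "real^3 \<Rightarrow> real^3"
  assumes "open \<Omega>" and "convex \<Omega>" and "\<Omega> \<noteq> {}"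
    and "displacement_field \<Omega> u"
  shows "universal_for \<Omega> trigonal_class u \<longleftrightarrow>
    (\<exists>u_hom u_inh. homogeneous_field \<Omega> u_hom \<and>
      (\<exists>a123 a12 a13 a23 b13 :: real. \<forall>x\<in>\<Omega>.
        u_inh x $ 1 = a123 * x$1 * x$2 * x$3 + a12 * x$1 * x$2 + a13 * x$1 * x$3 + a23 * x$2 * x$3 \<and>
        u_inh x $ 2 = 1/2 * (a12 + a123 * x$3) * ((x$1)\<^sup>2 - (x$2)\<^sup>2) + b13 * x$1 * x$3 - a13 * x$2 * x$3 \<and>
        u_inh x $ 3 = - a123 * (x$1)\<^sup>2 * x$2 - (a23 + b13) * x$1 * x$2 + 1/3 * a123 * (x$2)^3
                      - a13 * ((x$1)\<^sup>2 - (x$2)\<^sup>2)) \<and>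
      (\<forall>x\<in>\<Omega>. u x = u_hom x + u_inh x))"
    (is "_ \<longleftrightarrow> ?form")
proof -
  have u: "smooth_on \<Omega> u" using assms(4) by (simp add: displacement_field_def)
  \<comment> \<open>Packing the three scalar formulas into one vector equation reduces the last
    equivalence of the chain to handling quantifiers.\<close>
  have inh_iff: "(y $ 1 = a * x$1 * x$2 * x$3 + b * x$1 * x$2 + c * x$1 * x$3 + d * x$2 * x$3 \<and>
        y $ 2 = 1/2 * (b + a * x$3) * ((x$1)\<^sup>2 - (x$2)\<^sup>2) + e * x$1 * x$3 - c * x$2 * x$3 \<and>
        y $ 3 = - a * (x$1)\<^sup>2 * x$2 - (d + e) * x$1 * x$2 + 1/3 * a * (x$2)^3
                      - c * ((x$1)\<^sup>2 - (x$2)\<^sup>2)) \<longleftrightarrow>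
      y = (\<chi> l. inhomogeneous_part a b c d e l x)" for x y :: "real^3" and a b c d e :: real
    by (simp add: vec_eq_iff forall_3 inhomogeneous_part_def)
  have "universal_for \<Omega> trigonal_class u \<longleftrightarrow> (\<exists>a b c d e. \<forall>x\<in>\<Omega>. \<forall>l j k. hessian u l j k x =
      trigonal_hessian (a * x$3 + b) (a * x$2 + c) (a * x$1 + d) (a * x$1 + e) l j k)"
  proof
    assume "universal_for \<Omega> trigonal_class u"
    from universal_imp_trigonal_hessian[OF assms(1) u this]
    show "\<exists>a b c d e. \<forall>x\<in>\<Omega>. \<forall>l j k. hessian u l j k x =
        trigonal_hessian (a * x$3 + b) (a * x$2 + c) (a * x$1 + d) (a * x$1 + e) l j k"
      by (intro trigonal_hessian_integrable[OF assms(1,2) u]) (metis (no_types, lifting))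
  qed (blast intro: trigonal_hessian_imp_universal[OF assms(1) u])
  \<comment> \<open>Double integration with the five constants kept fixed: \<open>H\<close> and
    \<open>w\<close> collect what second derivatives do not see, which is the homogeneous
    field.\<close>
  also have "\<dots> \<longleftrightarrow> (\<exists>a b c d e. \<exists>(H :: real^3^3) w. \<forall>x\<in>\<Omega>.
      u x = (H *v x + w) + (\<chi> l. inhomogeneous_part a b c d e l x))"
    unfolding hessian_eq_iff[OF assms(1,2) u] by (simp add: vec_eq_iff)
  also have "\<dots> \<longleftrightarrow> ?form"
    unfolding inh_iff homogeneous_field_def
  proof
    assume "\<exists>a b c d e. \<exists>(H :: real^3^3) w. \<forall>x\<in>\<Omega>.
      u x = (H *v x + w) + (\<chi> l. inhomogeneous_part a b c d e l x)"
    then obtain a b c d e and H :: "real^3^3" and w where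
      eq: "\<forall>x\<in>\<Omega>. u x = (H *v x + w) + (\<chi> l. inhomogeneous_part a b c d e l x)" by blast
    then show "\<exists>u_hom u_inh. (\<exists>(H :: real^3^3) b. \<forall>x\<in>\<Omega>. u_hom x = H *v x + b) \<and>
      (\<exists>a b c d e. \<forall>x\<in>\<Omega>. u_inh x = (\<chi> l. inhomogeneous_part a b c d e l x)) \<and>
      (\<forall>x\<in>\<Omega>. u x = u_hom x + u_inh x)"
      by (intro exI[of _ "\<lambda>x. H *v x + w"] exI[of _ "\<lambda>x. \<chi> l. inhomogeneous_part a b c d e l x"]) blast
  next
    assume "\<exists>u_hom u_inh. (\<exists>(H :: real^3^3) b. \<forall>x\<in>\<Omega>. u_hom x = H *v x + b) \<and>
      (\<exists>a b c d e. \<forall>x\<in>\<Omega>. u_inh x = (\<chi> l. inhomogeneous_part a b c d e l x)) \<and>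
      (\<forall>x\<in>\<Omega>. u x = u_hom x + u_inh x)"
    then show "\<exists>a b c d e. \<exists>(H :: real^3^3) w. \<forall>x\<in>\<Omega>.
      u x = (H *v x + w) + (\<chi> l. inhomogeneous_part a b c d e l x)"
      by metis
  qed
  finally show ?thesis .
qed

end
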